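(* Let $\mathbb{K}$ be an algebraically closed field of characteristic $0$, let $A=(a_{ij})_{i,j\in I}$ be a symmetrizable generalized Cartan matrix, let $\mathbf q=(q_{ij})_{i,j\in I}$ be parameters in $\mathbb K^\times$ with $q_{ij}q_{ji}=q_{ii}^{a_{ij}}$, and let $(\hat q_{ij})_{i,j\in I}$ be a matrix over $\mathbb K$ with $\hat q_{ii}=q_{ii}$ and $\hat q_{ij}\hat q_{ji}=q_{ij}q_{ji}$ for all $i,j\in I$. Let $H$, $M$, $T_H^c(M)$, $T_H^c(M^\sigma)$ (with their Hopf algebra structures of quasi-symmetric type given by $\alpha$ and $\alpha_\sigma$ respectively) be as in the context, where $\sigma$ is a bicharacter on $\Gamma=\mathbb Z^{2|I|}$ with $\sigma(K_i,K_j)\sigma^{-1}(K_j,K_i)=\hat q_{ij}q_{ij}^{-1}$, $\sigma(K_i',K_j')\sigma^{-1}(K_j',K_i')=\hat q_{ij}q_{ij}^{-1}$, $\sigma(K_i',K_j)\sigma^{-1}(K_j,K_i')=\hat q_{ji}^{-1}q_{ji}$ for all $i,j\in I$. Let $T_H^c(M)^\sigma$ be the $2$-cocycle deformation of the Hopf algebra $T_H^c(M)$ by the Hopf $2$-cocycle obtained by pulling $\sigma$ back along the projection $\pi_0:T_H^c(M)\to H$ onto degree $0$. If $\sigma(K_i,K_i')=1$ for all $i\in I$, then the identity map on the underlying space of $T_H^c(M)$ is an isomorphism of Hopf algebras between $T_H^c(M^\sigma)$ and $T_H^c(M)^\sigma$.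
   Context: **Hopf algebras of quasi-symmetric type on cotensor coalgebras.** Let $H$ be a Hopf algebra and $M$ an $H$-Hopf bimodule with coactions $\delta_L,\delta_R$. For bicomodules, $M\Box_HN=\mathrm{Ker}(\delta_R\otimes\mathrm{id}_N-\mathrm{id}_M\otimes\delta_L)\subset M\otimes N$. The cotensor coalgebra is $T_H^c(M)=\bigoplus_{k\ge0}M^{\Box_Hk}$ ($M^{\Box0}=H$), with coproduct that of $H$ in degree $0$ and, for $n\ge1$, $\Delta(m_1\otimes\cdots\otimes m_n)={m_1}_{(-1)}\underline\otimes({m_1}_{(0)}\otimes\cdots\otimes m_n)+\sum_{i=1}^{n-1}(m_1\otimes\cdots\otimes m_i)\underline\otimes(m_{i+1}\otimes\cdots\otimes m_n)+(m_1\otimes\cdots\otimes{m_n}_{(0)})\underline\otimes{m_n}_{(1)}$, and counit $\varepsilon_H$ composed with the projection onto degree $0$. Given an associative $H$-Hopf bimodule map $\alpha:M\otimes M\to M$ factoring through $M\otimes_HM$, put $D=T_H^c(M)\underline\otimes T_H^c(M)$ (tensor product coalgebra), let $g:D\to H$ be the multiplication of $H$ on $H\underline\otimes H$ and $0$ on other homogeneous components, and $f:D\to M$ be the left action on $H\underline\otimes M$, the right action on $M\underline\otimes H$, $\alpha$ on $M\underline\otimes M$, $0$ on other components. Then $*=g+\sum_{n\ge1}f^{\otimes n}\Delta_D^{(n-1)}$ makes $T_H^c(M)$ a Hopf algebra (of quasi-symmetric type, given by $\alpha$). **The data.** $I$ is finite and $q_{ii}\ne1$ for all $i$. $H=\mathbb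 K[K_i^{\pm1},{K_i'}^{\pm1}:i\in I]$ is the group algebra of $\Gamma=\mathbb Z^{2|I|}$; $W$ has basis $\{E_i,F_i,\xi_i:i\in I\}$ with $K_i\cdot E_j=q_{ij}E_j$, $K_i\cdot F_j=q_{ij}^{-1}F_j$, $K_i'\cdot E_j=q_{ji}^{-1}E_j$, $K_i'\cdot F_j=q_{ji}F_j$, $K_i\cdot\xi_j=K_i'\cdot\xi_j=\xi_j$, $\delta_L(E_i)=K_i\otimes E_i$, $\delta_L(F_i)={K_i'}^{-1}\otimes F_i$, $\delta_L(\xi_i)=K_i{K_i'}^{-1}\otimes\xi_i$. $M=W\otimes H$ (write $xK$ for $x\otimes K$) has right action/coaction those of the factor $H$, and left action/coaction the tensor product (diagonal) ones. For $K,K'\in\Gamma$ with $K\cdot F_j=\lambda F_j$, $\alpha=\alpha_M$ is given by $\alpha(E_iK\otimes F_jK')=\delta_{ij}\frac{q_{ii}\lambda}{q_{ii}-1}\xi_iKK'$, and $\alpha=0$ on all other pairs of basis elements. Let $\hat W$ (basis $\hat E_i,\hat F_i,\hat\xi_i$), $\hat M=\hat W\otimes H$, $\alpha_{\hat M}$ be the analogous objects with all $q_{ij}$ replaced by $\hat q_{ij}$. **Twisting.** The bicharacter $\sigma:\Gamma\times\Gamma\to\mathbb K^\times$ is extended linearly to a Hopf $2$-cocycle on $H$; $H^\sigma=H$. $M^\sigma$ is $M$ with the same coactions and with actions $h\bullet_\sigma m=\sigma(h_{(1)},m_{(-1)})\sigma^{-1}(h_{(3)},m_{(1)})\,h_{(2)}m_{(0)}$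 and $m\bullet_\sigma h=\sigma(m_{(-1)},h_{(1)})\sigma^{-1}(m_{(1)},h_{(3)})\,m_{(0)}h_{(2)}$. There is an isomorphism of $H$-Hopf bimodules $\phi:M^\sigma\to\hat M$ given by $x\otimes K\mapsto\sigma(x_{(-1)},K^{-1})\,\hat x_{(0)}\otimes K$ for $x\in W$, $K\in\Gamma$, where $x\mapsto\hat x$ is the linear map $E_i\mapsto\hat E_i$, $F_i\mapsto\hat F_i$, $\xi_i\mapsto\hat\xi_i$. Set $\alpha_\sigma=\phi^{-1}\circ\alpha_{\hat M}\circ(\phi\otimes\phi)$; $T_H^c(M^\sigma)$ carries the Hopf structure given by $\alpha_\sigma$. For a Hopf algebra $B$ with Hopf $2$-cocycle $\sigma$, $B^\sigma$ is the Hopf algebra with the same coalgebra structure and multiplication $a\cdot_\sigma b=\sigma(a_{(1)},b_{(1)})a_{(2)}b_{(2)}\sigma^{-1}(a_{(3)},b_{(3)})$, with $\sigma^{-1}$ the convolution inverse. *)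

theory Defs
  imports
    Complex_Main
    "HOL-Library.Poly_Mapping"
    "HOL-Library.Function_Algebras"
    "HOL-Computational_Algebra.Polynomial"
begin

section \<open>Linear algebra on free vector spaces\<close>

text \<open>
  The vector space with basis \<open>'b\<close> over \<open>'k\<close> is \<open>'b \<Rightarrow>\<^sub>0 'k\<close>, and the tensor product of the spaces
  with bases \<open>'a\<close> and \<open>'b\<close> is the space with basis \<open>'a \<times> 'b\<close>. A linear map (or linear form) on such a
  space is given by its values on the basis, i.e. by a function \<open>'a \<Rightarrow> 'b \<Rightarrow>\<^sub>0 'k\<close> (or \<open>'a \<Rightarrow> 'k\<close>), whose
  linear extension is \<open>lin\<close> (or \<open>lfun\<close>).
\<close>

definition smul :: "'k::field \<Rightarrow> ('b \<Rightarrow>\<^sub>0 'k) \<Rightarrow> ('b \<Rightarrow>\<^sub>0 'k)" where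
  "smul c = Poly_Mapping.map ((*) c)"

abbreviation bas :: "'b \<Rightarrow> ('b \<Rightarrow>\<^sub>0 'k::field)" where
  "bas b \<equiv> Poly_Mapping.single b 1"

definition lin :: "('a \<Rightarrow> ('b \<Rightarrow>\<^sub>0 'k)) \<Rightarrow> ('a \<Rightarrow>\<^sub>0 'k::field) \<Rightarrow> ('b \<Rightarrow>\<^sub>0 'k)" where
  "lin f v = (\<Sum>a\<in>Poly_Mapping.keys v. smul (Poly_Mapping.lookup v a) (f a))"

definition lfun :: "('a \<Rightarrow> 'k) \<Rightarrow> ('a \<Rightarrow>\<^sub>0 'k::field) \<Rightarrow> 'k" where
  "lfun f v = (\<Sum>a\<in>Poly_Mapping.keys v. Poly_Mapping.lookup v a * f a)"

definition push :: "('a \<Rightarrow> 'b) \<Rightarrow> ('a \<Rightarrow>\<^sub>0 'k::field) \<Rightarrow> ('b \<Rightarrow>\<^sub>0 'k)" where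
  "push h = lin (\<lambda>a. bas (h a))"

definition tens :: "('a \<Rightarrow>\<^sub>0 'k::field) \<Rightarrow> ('b \<Rightarrow>\<^sub>0 'k) \<Rightarrow> ('a \<times> 'b \<Rightarrow>\<^sub>0 'k)" where
  "tens v w = lin (\<lambda>a. lin (\<lambda>b. bas (a, b)) w) v"

definition tmap :: "('a \<Rightarrow> ('c \<Rightarrow>\<^sub>0 'k::field)) \<Rightarrow> ('b \<Rightarrow> ('d \<Rightarrow>\<^sub>0 'k)) \<Rightarrow> 'a \<times> 'b \<Rightarrow> ('c \<times> 'd \<Rightarrow>\<^sub>0 'k)" where
  "tmap f g = (\<lambda>(a, b). tens (f a) (g b))"

definition tensor_space ::
    "('a \<Rightarrow>\<^sub>0 'k::field) set \<Rightarrow> ('b \<Rightarrow>\<^sub>0 'k) set \<Rightarrow> ('a \<times> 'b \<Rightarrow>\<^sub>0 'k) set" where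
  "tensor_space A B = module.span smul {tens a b | a b. a \<in> A \<and> b \<in> B}"

definition assoc_tens :: "(('a \<times> 'b) \<times> 'c \<Rightarrow>\<^sub>0 'k::field) \<Rightarrow> ('a \<times> ('b \<times> 'c) \<Rightarrow>\<^sub>0 'k)" where
  "assoc_tens = push (\<lambda>((a, b), c). (a, (b, c)))"


section \<open>Hopf algebras\<close>

text \<open>
  A Hopf algebra is carried by a subspace of a free vector space. Its structure maps are linear maps
  on the ambient space; only their restrictions to the carrier matter, and every linear map on the
  carrier arises in this way.
\<close>

record (overloaded) ('b, 'k) hopf =
  hcarrier :: "('b \<Rightarrow>\<^sub>0 'k) set"
  hmult    :: "'b \<times> 'b \<Rightarrow> ('b \<Rightarrow>\<^sub>0 'k)"
  hunit    :: "'b \<Rightarrow>\<^sub>0 'k"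
  hcomult  :: "'b \<Rightarrow> ('b \<times> 'b \<Rightarrow>\<^sub>0 'k)"
  hcounit  :: "'b \<Rightarrow> 'k"

definition tensor_comult ::
    "('b \<Rightarrow> ('b \<times> 'b \<Rightarrow>\<^sub>0 'k::field)) \<Rightarrow> 'b \<times> 'b \<Rightarrow> (('b \<times> 'b) \<times> ('b \<times> 'b) \<Rightarrow>\<^sub>0 'k)" where
  "tensor_comult \<Delta> = (\<lambda>(a, b).
     push (\<lambda>((a1, a2), (b1, b2)). ((a1, b1), (a2, b2))) (tens (\<Delta> a) (\<Delta> b)))"

definition is_algebra :: "('b, 'k::field) hopf \<Rightarrow> bool" where
  "is_algebra B \<longleftrightarrow>
     (let A = hcarrier B; m = (\<lambda>v w. lin (hmult B) (tens v w)) in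
       module.subspace smul A \<and> hunit B \<in> A \<and>
       (\<forall>v\<in>A. \<forall>w\<in>A. m v w \<in> A) \<and>
       (\<forall>u\<in>A. \<forall>v\<in>A. \<forall>w\<in>A. m (m u v) w = m u (m v w)) \<and>
       (\<forall>v\<in>A. m (hunit B) v = v \<and> m v (hunit B) = v))"

definition is_coalgebra :: "('b, 'k::field) hopf \<Rightarrow> bool" where
  "is_coalgebra B \<longleftrightarrow>
     (let A = hcarrier B; \<Delta> = hcomult B; \<epsilon> = hcounit B in
       module.subspace smul A \<and>
       (\<forall>v\<in>A. lin \<Delta> v \<in> tensor_space A A) \<and>
       (\<forall>v\<in>A. assoc_tens (lin (tmap \<Delta> bas) (lin \<Delta> v)) = lin (tmap bas \<Delta>) (lin \<Delta> v)) \<and>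
       (\<forall>v\<in>A. lin (\<lambda>(a, b). smul (\<epsilon> a) (bas b)) (lin \<Delta> v) = v \<and>
              lin (\<lambda>(a, b). smul (\<epsilon> b) (bas a)) (lin \<Delta> v) = v))"

definition is_bialgebra :: "('b, 'k::field) hopf \<Rightarrow> bool" where
  "is_bialgebra B \<longleftrightarrow>
     is_algebra B \<and> is_coalgebra B \<and>
     (let A = hcarrier B; \<Delta> = hcomult B; \<epsilon> = hcounit B; m = (\<lambda>v w. lin (hmult B) (tens v w)) in
       (\<forall>v\<in>A. \<forall>w\<in>A. lin \<Delta> (m v w) =
          lin (tmap (hmult B) (hmult B)) (lin (tensor_comult \<Delta>) (tens v w))) \<and>
       lin \<Delta> (hunit B) = tens (hunit B) (hunit B) \<and>
       (\<forall>v\<in>A. \<forall>w\<in>A. lfun \<epsilon> (m v w) = lfun \<epsilon> v * lfun \<epsilon> w) \<and>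
       lfun \<epsilon> (hunit B) = 1)"

definition is_hopf_algebra :: "('b, 'k::field) hopf \<Rightarrow> bool" where
  "is_hopf_algebra B \<longleftrightarrow>
     is_bialgebra B \<and>
     (\<exists>S :: 'b \<Rightarrow> ('b \<Rightarrow>\<^sub>0 'k). \<forall>v\<in>hcarrier B. lin S v \<in> hcarrier B \<and>
        lin (hmult B) (lin (tmap S bas) (lin (hcomult B) v)) = smul (lfun (hcounit B) v) (hunit B) \<and>
        lin (hmult B) (lin (tmap bas S) (lin (hcomult B) v)) = smul (lfun (hcounit B) v) (hunit B))"

text \<open>Compatibility with the antipodes is automatic for bialgebra maps between Hopf algebras.\<close>

definition is_hopf_iso ::
    "('b, 'k::field) hopf \<Rightarrow> ('c, 'k) hopf \<Rightarrow> (('b \<Rightarrow>\<^sub>0 'k) \<Rightarrow> ('c \<Rightarrow>\<^sub>0 'k)) \<Rightarrow> bool" where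
  "is_hopf_iso B C \<phi> \<longleftrightarrow>
     is_hopf_algebra B \<and> is_hopf_algebra C \<and>
     Vector_Spaces.linear smul smul \<phi> \<and> bij_betw \<phi> (hcarrier B) (hcarrier C) \<and>
     (\<forall>v\<in>hcarrier B. \<forall>w\<in>hcarrier B.
        \<phi> (lin (hmult B) (tens v w)) = lin (hmult C) (tens (\<phi> v) (\<phi> w))) \<and>
     \<phi> (hunit B) = hunit C \<and>
     (\<forall>v\<in>hcarrier B.
        lin (tmap (\<lambda>b. \<phi> (bas b)) (\<lambda>b. \<phi> (bas b))) (lin (hcomult B) v) = lin (hcomult C) (\<phi> v)) \<and>
     (\<forall>v\<in>hcarrier B. lfun (hcounit B) v = lfun (hcounit C) (\<phi> v))"


section \<open>Deformation by a 2-cocycle\<close>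

definition convolution ::
    "('b, 'k::field) hopf \<Rightarrow> ('b \<times> 'b \<Rightarrow> 'k) \<Rightarrow> ('b \<times> 'b \<Rightarrow> 'k) \<Rightarrow> ('b \<times> 'b \<Rightarrow>\<^sub>0 'k) \<Rightarrow> 'k" where
  "convolution B s t v = lfun (\<lambda>(d, d'). s d * t d') (lin (tensor_comult (hcomult B)) v)"

definition is_conv_inverse ::
    "('b, 'k::field) hopf \<Rightarrow> ('b \<times> 'b \<Rightarrow> 'k) \<Rightarrow> ('b \<times> 'b \<Rightarrow> 'k) \<Rightarrow> bool" where
  "is_conv_inverse B s t \<longleftrightarrow>
     (\<forall>v\<in>tensor_space (hcarrier B) (hcarrier B).
        convolution B s t v = lfun (\<lambda>(a, b). hcounit B a * hcounit B b) v \<and>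
        convolution B t s v = lfun (\<lambda>(a, b). hcounit B a * hcounit B b) v)"

text \<open>On the carrier a convolution inverse is unique; the choice only concerns its values elsewhere.\<close>

definition conv_inv :: "('b, 'k::field) hopf \<Rightarrow> ('b \<times> 'b \<Rightarrow> 'k) \<Rightarrow> 'b \<times> 'b \<Rightarrow> 'k" where
  "conv_inv B s = (SOME t. is_conv_inverse B s t)"

definition cocycle_deform :: "('b, 'k::field) hopf \<Rightarrow> ('b \<times> 'b \<Rightarrow> 'k) \<Rightarrow> ('b, 'k) hopf" where
  "cocycle_deform B s = B \<lparr> hmult := (\<lambda>d.
     lin (\<lambda>(d1, d2, d3). smul (s d1 * conv_inv B s d3) (hmult B d2))
       (lin (tmap bas (tensor_comult (hcomult B))) (tensor_comult (hcomult B) d))) \<rparr>"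

definition pullback_form ::
    "('b \<Rightarrow> ('g \<Rightarrow>\<^sub>0 'k::field)) \<Rightarrow> ('g \<Rightarrow> 'g \<Rightarrow> 'k) \<Rightarrow> 'b \<times> 'b \<Rightarrow> 'k" where
  "pullback_form p \<sigma> = (\<lambda>(a, b). lfun (\<lambda>(g, h). \<sigma> g h) (tens (p a) (p b)))"


section \<open>Hopf bimodules over a group algebra and the cotensor coalgebra\<close>

text \<open>
  \<open>H\<close> is the group algebra \<open>'g \<Rightarrow>\<^sub>0 'k\<close> of an additively written abelian group \<open>'g\<close> (with the
  convolution product of \<open>Poly_Mapping\<close>); every \<open>g\<close> is group-like.
\<close>

record (overloaded) ('g, 'm, 'k) bimod =
  lact   :: "'g \<times> 'm \<Rightarrow> ('m \<Rightarrow>\<^sub>0 'k)"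
  ract   :: "'m \<times> 'g \<Rightarrow> ('m \<Rightarrow>\<^sub>0 'k)"
  lcoact :: "'m \<Rightarrow> ('g \<times> 'm \<Rightarrow>\<^sub>0 'k)"
  rcoact :: "'m \<Rightarrow> ('m \<times> 'g \<Rightarrow>\<^sub>0 'k)"

definition cotensor ::
    "('m \<Rightarrow> ('m \<times> 'g \<Rightarrow>\<^sub>0 'k::field)) \<Rightarrow> ('n \<Rightarrow> ('g \<times> 'n \<Rightarrow>\<^sub>0 'k)) \<Rightarrow>
     ('m \<Rightarrow>\<^sub>0 'k) set \<Rightarrow> ('n \<Rightarrow>\<^sub>0 'k) set \<Rightarrow> ('m \<times> 'n \<Rightarrow>\<^sub>0 'k) set" where
  "cotensor \<delta>R \<delta>L A B =
     {t \<in> tensor_space A B. assoc_tens (lin (tmap \<delta>R bas) t) = lin (tmap bas \<delta>L) t}"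

text \<open>The \<open>n\<close>-th tensor power of \<open>M\<close> has as basis the lists of length \<open>n\<close> over the basis of \<open>M\<close>.\<close>

definition lcoact_list ::
    "('m \<Rightarrow> ('g \<times> 'm \<Rightarrow>\<^sub>0 'k::field)) \<Rightarrow> 'm list \<Rightarrow> ('g \<times> 'm list \<Rightarrow>\<^sub>0 'k)" where
  "lcoact_list \<delta>L ms =
     (case ms of [] \<Rightarrow> 0 | m # ms' \<Rightarrow> push (\<lambda>(g, m'). (g, m' # ms')) (\<delta>L m))"

text \<open>\<open>cotensor_power M n\<close> is the \<open>(n + 1)\<close>-st cotensor power of \<open>M\<close>.\<close>

primrec cotensor_power :: "('g, 'm, 'k::field) bimod \<Rightarrow> nat \<Rightarrow> ('m list \<Rightarrow>\<^sub>0 'k) set" where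
  "cotensor_power M 0 = push (\<lambda>m. [m]) ` UNIV"
| "cotensor_power M (Suc n) =
     push (\<lambda>(m, ms). m # ms) `
       cotensor (rcoact M) (lcoact_list (lcoact M)) UNIV (cotensor_power M n)"

text \<open>
  Basis of \<open>H \<oplus> M \<oplus> (M \<otimes> M) \<oplus> \<dots>\<close>: \<open>Grp g\<close> for degree 0 and \<open>Word ms\<close> for nonempty \<open>ms\<close> in degree
  \<open>length ms\<close>. The junk value \<open>Word []\<close> does not occur in the cotensor coalgebra.
\<close>

datatype ('g, 'm) word = Grp 'g | Word "'m list"

definition cotensor_carrier :: "('g, 'm, 'k::field) bimod \<Rightarrow> (('g, 'm) word \<Rightarrow>\<^sub>0 'k) set" where
  "cotensor_carrier M =
     module.span smul (push Grp ` UNIV \<union> (\<Union>n. push Word ` cotensor_power M n))"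

definition word_comult ::
    "('g, 'm, 'k::field) bimod \<Rightarrow> ('g, 'm) word \<Rightarrow> (('g, 'm) word \<times> ('g, 'm) word \<Rightarrow>\<^sub>0 'k)" where
  "word_comult M w = (case w of
     Grp g \<Rightarrow> bas (Grp g, Grp g)
   | Word ms \<Rightarrow> if ms = [] then 0 else
       push (\<lambda>(g, m). (Grp g, Word (m # tl ms))) (lcoact M (hd ms))
       + (\<Sum>i\<in>{1..<length ms}. bas (Word (take i ms), Word (drop i ms)))
       + push (\<lambda>(m, g). (Word (butlast ms @ [m]), Grp g)) (rcoact M (last ms)))"

definition word_counit :: "('g, 'm) word \<Rightarrow> 'k::field" where
  "word_counit w = (case w of Grp g \<Rightarrow> 1 | Word ms \<Rightarrow> 0)"

definition degree0_proj :: "('g, 'm) word \<Rightarrow> ('g \<Rightarrow>\<^sub>0 'k::field)" where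
  "degree0_proj w = (case w of Grp g \<Rightarrow> bas g | Word ms \<Rightarrow> 0)"


section \<open>The product of quasi-symmetric type\<close>

definition qs_g :: "('g::ab_group_add, 'm) word \<times> ('g, 'm) word \<Rightarrow> ('g \<Rightarrow>\<^sub>0 'k::field)" where
  "qs_g d = (case d of (Grp g, Grp h) \<Rightarrow> bas g * bas h | _ \<Rightarrow> 0)"

definition qs_f ::
    "('g, 'm, 'k::field) bimod \<Rightarrow> ('m \<times> 'm \<Rightarrow> ('m \<Rightarrow>\<^sub>0 'k)) \<Rightarrow>
     ('g, 'm) word \<times> ('g, 'm) word \<Rightarrow> ('m \<Rightarrow>\<^sub>0 'k)" where
  "qs_f M \<alpha> d = (case d of
     (Grp g, Word [m]) \<Rightarrow> lact M (g, m)
   | (Word [m], Grp g) \<Rightarrow> ract M (m, g)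
   | (Word [m], Word [m']) \<Rightarrow> \<alpha> (m, m')
   | _ \<Rightarrow> 0)"

text \<open>\<open>iter_comult \<Delta> n\<close> is the \<open>n\<close>-fold iterated coproduct \<open>\<Delta>\<^sup>(\<^sup>n\<^sup>)\<close>, with values in the \<open>(n + 1)\<close>-st tensor power.\<close>

primrec iter_comult :: "('d \<Rightarrow> ('d \<times> 'd \<Rightarrow>\<^sub>0 'k::field)) \<Rightarrow> nat \<Rightarrow> 'd \<Rightarrow> ('d list \<Rightarrow>\<^sub>0 'k)" where
  "iter_comult \<Delta> 0 d = bas [d]"
| "iter_comult \<Delta> (Suc n) d =
     push (\<lambda>(d', ds). d' # ds) (lin (tmap bas (iter_comult \<Delta> n)) (\<Delta> d))"

primrec tensor_power_map :: "('d \<Rightarrow> ('m \<Rightarrow>\<^sub>0 'k::field)) \<Rightarrow> 'd list \<Rightarrow> ('m list \<Rightarrow>\<^sub>0 'k)" where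
  "tensor_power_map f [] = bas []"
| "tensor_power_map f (d # ds) = push (\<lambda>(m, ms). m # ms) (tens (f d) (tensor_power_map f ds))"

text \<open>
  The sum over \<open>n \<ge> 1\<close> of the \<open>n\<close>-th tensor power of \<open>f\<close> after the \<open>(n - 1)\<close>-fold iterated coproduct,
  reindexed from 0. On each basis element all but finitely many terms vanish.
\<close>

definition qs_mult ::
    "('g::ab_group_add, 'm, 'k::field) bimod \<Rightarrow> ('m \<times> 'm \<Rightarrow> ('m \<Rightarrow>\<^sub>0 'k)) \<Rightarrow>
     ('g, 'm) word \<times> ('g, 'm) word \<Rightarrow> (('g, 'm) word \<Rightarrow>\<^sub>0 'k)" where
  "qs_mult M \<alpha> d =
     push Grp (qs_g d) +
     Sum_any (\<lambda>n. push Word (lin (tensor_power_map (qs_f M \<alpha>))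
       (iter_comult (tensor_comult (word_comult M)) n d)))"

definition qs_hopf ::
    "('g::ab_group_add, 'm, 'k::field) bimod \<Rightarrow> ('m \<times> 'm \<Rightarrow> ('m \<Rightarrow>\<^sub>0 'k)) \<Rightarrow>
     (('g, 'm) word, 'k) hopf" where
  "qs_hopf M \<alpha> =
     \<lparr> hcarrier = cotensor_carrier M,
       hmult = qs_mult M \<alpha>,
       hunit = bas (Grp 0),
       hcomult = word_comult M,
       hcounit = word_counit \<rparr>"


section \<open>Bicharacters and the twisted bimodule\<close>

definition bicharacter :: "('g::ab_group_add \<Rightarrow> 'g \<Rightarrow> 'k::field) \<Rightarrow> bool" where
  "bicharacter \<sigma> \<longleftrightarrow>
     (\<forall>a b c. \<sigma> (a + b) c = \<sigma> a c * \<sigma> b c) \<and>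
     (\<forall>a b c. \<sigma> a (b + c) = \<sigma> a b * \<sigma> a c) \<and>
     (\<forall>a b. \<sigma> a b \<noteq> 0)"

definition bicoact :: "('g, 'm, 'k::field) bimod \<Rightarrow> 'm \<Rightarrow> ('g \<times> ('m \<times> 'g) \<Rightarrow>\<^sub>0 'k)" where
  "bicoact M m = lin (tmap bas (rcoact M)) (lcoact M m)"

text \<open>
  As each \<open>h\<close> is group-like, \<open>h\<^sub>(\<^sub>1\<^sub>)\<close>, \<open>h\<^sub>(\<^sub>2\<^sub>)\<close>, \<open>h\<^sub>(\<^sub>3\<^sub>)\<close> are all \<open>h\<close>, and the convolution inverse of \<open>\<sigma>\<close>
  is its pointwise inverse on pairs of group elements.
\<close>

definition twist_bimod ::
    "('g \<Rightarrow> 'g \<Rightarrow> 'k::field) \<Rightarrow> ('g, 'm, 'k) bimod \<Rightarrow> ('g, 'm, 'k) bimod" where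
  "twist_bimod \<sigma> M = M \<lparr>
     lact := (\<lambda>(h, m). lin (\<lambda>(g, m0, k). smul (\<sigma> h g * inverse (\<sigma> h k)) (lact M (h, m0))) (bicoact M m)),
     ract := (\<lambda>(m, h). lin (\<lambda>(g, m0, k). smul (\<sigma> g h * inverse (\<sigma> k h)) (ract M (m0, h))) (bicoact M m)) \<rparr>"


section \<open>The Hopf bimodule of the multiparameter quantum group\<close>

definition symmetrizable_GCM :: "('i::finite \<Rightarrow> 'i \<Rightarrow> int) \<Rightarrow> bool" where
  "symmetrizable_GCM A \<longleftrightarrow>
     (\<forall>i. A i i = 2) \<and>
     (\<forall>i j. i \<noteq> j \<longrightarrow> A i j \<le> 0) \<and>
     (\<forall>i j. A i j = 0 \<longleftrightarrow> A j i = 0) \<and>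
     (\<exists>d :: 'i \<Rightarrow> int. (\<forall>i. d i > 0) \<and> (\<forall>i j. d i * A i j = d j * A j i))"

text \<open>The free abelian group of rank \<open>2|I|\<close>; the generator indexed by \<open>Inl i\<close> is \<open>K\<^sub>i\<close>, by \<open>Inr i\<close> is \<open>K'\<^sub>i\<close>.\<close>

type_synonym 'i \<Gamma> = "'i + 'i \<Rightarrow> int"

definition gK :: "'i \<Rightarrow> 'i \<Gamma>" where
  "gK i = (\<lambda>s. if s = Inl i then 1 else 0)"

definition gK' :: "'i \<Rightarrow> 'i \<Gamma>" where
  "gK' i = (\<lambda>s. if s = Inr i then 1 else 0)"

datatype 'i letter = E 'i | F 'i | Xi 'i

primrec letter_degree :: "'i letter \<Rightarrow> 'i \<Gamma>" where
  "letter_degree (E i) = gK i"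
| "letter_degree (F i) = - gK' i"
| "letter_degree (Xi i) = gK i - gK' i"

text \<open>Eigenvalue on a basis element of \<open>W\<close> of a generator, and of an arbitrary element, of the group.\<close>

fun gen_eigenvalue :: "('i \<Rightarrow> 'i \<Rightarrow> 'k::field) \<Rightarrow> 'i + 'i \<Rightarrow> 'i letter \<Rightarrow> 'k" where
  "gen_eigenvalue q (Inl i) (E j) = q i j"
| "gen_eigenvalue q (Inl i) (F j) = inverse (q i j)"
| "gen_eigenvalue q (Inl i) (Xi j) = 1"
| "gen_eigenvalue q (Inr i) (E j) = inverse (q j i)"
| "gen_eigenvalue q (Inr i) (F j) = q j i"
| "gen_eigenvalue q (Inr i) (Xi j) = 1"

definition eigenvalue :: "('i::finite \<Rightarrow> 'i \<Rightarrow> 'k::field) \<Rightarrow> 'i \<Gamma> \<Rightarrow> 'i letter \<Rightarrow> 'k" where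
  "eigenvalue q K x = (\<Prod>s\<in>UNIV. gen_eigenvalue q s x powi K s)"

text \<open>\<open>M = W \<otimes> H\<close>; the basis element \<open>(x, K)\<close> is \<open>x \<otimes> K\<close>.\<close>

type_synonym 'i mbasis = "'i letter \<times> 'i \<Gamma>"

definition M_bimod :: "('i::finite \<Rightarrow> 'i \<Rightarrow> 'k::field) \<Rightarrow> ('i \<Gamma>, 'i mbasis, 'k) bimod" where
  "M_bimod q =
     \<lparr> lact = (\<lambda>(h, (x, K)). smul (eigenvalue q h x) (bas (x, h + K))),
       ract = (\<lambda>((x, K), h). bas (x, K + h)),
       lcoact = (\<lambda>(x, K). bas (letter_degree x + K, (x, K))),
       rcoact = (\<lambda>(x, K). bas ((x, K), K)) \<rparr>"

definition \<alpha>_M :: "('i::finite \<Rightarrow> 'i \<Rightarrow> 'k::field) \<Rightarrow> 'i mbasis \<times> 'i mbasis \<Rightarrow> ('i mbasis \<Rightarrow>\<^sub>0 'k)" where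
  "\<alpha>_M q p = (case p of
     ((E i, K), (F j, K')) \<Rightarrow>
       if i = j then smul (q i i * eigenvalue q K (F j) / (q i i - 1)) (bas (Xi i, K + K')) else 0
   | _ \<Rightarrow> 0)"

text \<open>
  The hatted module is the one for the parameters \<open>qhat\<close>. It has the same basis type, so that the
  linear map removing hats is the identity on letters; \<open>\<phi>\<close> does not involve the parameters.
\<close>

definition \<phi>_iso :: "('i \<Gamma> \<Rightarrow> 'i \<Gamma> \<Rightarrow> 'k::field) \<Rightarrow> 'i mbasis \<Rightarrow> ('i mbasis \<Rightarrow>\<^sub>0 'k)" where
  "\<phi>_iso \<sigma> = (\<lambda>(x, K). smul (\<sigma> (letter_degree x) (- K)) (bas (x, K)))"

definition \<alpha>_twisted ::
    "('i::finite \<Rightarrow> 'i \<Rightarrow> 'k::field) \<Rightarrow> ('i \<Gamma> \<Rightarrow> 'i \<Gamma> \<Rightarrow> 'k) \<Rightarrow>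
     'i mbasis \<times> 'i mbasis \<Rightarrow> ('i mbasis \<Rightarrow>\<^sub>0 'k)" where
  "\<alpha>_twisted qhat \<sigma> p =
     inv (lin (\<phi>_iso \<sigma>)) (lin (\<alpha>_M qhat) (tmap (\<phi>_iso \<sigma>) (\<phi>_iso \<sigma>) p))"

end

(*
  The cotensor coalgebra of M = W (x) H has a basis of composable words: a word is a list xs of letters
  of W together with the group element g at its right end, all other group elements being forced by
  composability. On this basis the coproduct is deconcatenation, and the product of quasi-symmetric
  type is a quasi-shuffle whose n-th summand collects the words of length n. Hence
  (xs, g) * (ys, h) is a scalar times (xs * ys, g + h), where the scalar and the coefficients of the
  quasi-shuffle xs * ys come from the characters by which the group acts on letters.

  A twist by sigma multiplies these characters by sigma(g, deg x) and sigma(deg x, g). By induction on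
  the words the quasi-shuffle of xs and ys is then multiplied by sigma(deg xs, deg ys); the letter
  produced by alpha(E_i, F_i) causes no discrepancy exactly because sigma(K_i, K'_i) = 1. On the
  other side, the pullback of sigma and its convolution inverse see only the summands of the coproduct
  whose outer factors are group-like, so the deformed product of two words is the old one times
  sigma of the left ends divided by sigma of the right ends. The two factors agree.
*)
theory Submission
  imports Defs
begin

section \<open>Linear extension as a monad\<close>

text \<open>\<open>is_hopf_iso\<close> demands that both sides be Hopf algebras, so the axioms,
  antipode included, have to be proved in addition to the agreement of the products. They are proved
  once, in \<open>quasi_shuffle\<close>, for arbitrary left and right characters \<open>L\<close>
  and \<open>R\<close>. The right action of M carries no scalar, but its twist acts on a letter x by
  sigma(deg x, g); this is why \<open>R\<close> is a parameter, and why M and its twist become two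
  instances over the same basis. The deformed algebra inherits the axioms from the twisted instance,
  with which it agrees on the basis. Associativity could in general produce a letter merged from
  three. Here every merge is some xi_i, which alpha annihilates on either side; this is
  \<open>t_nilpotent\<close>. Cotensor powers are defined as kernels. They must be shown to be
  spanned by basis elements before any identity can be checked on words alone.\<close>

lemma lookup_smul [simp]: "Poly_Mapping.lookup (smul c v) b = c * Poly_Mapping.lookup v b"
  by (simp add: smul_def Poly_Mapping.map.rep_eq when_def)

interpretation fvs: vector_space "smul :: 'k::field \<Rightarrow> ('b \<Rightarrow>\<^sub>0 'k) \<Rightarrow> ('b \<Rightarrow>\<^sub>0 'k)"
  by unfold_locales (auto intro!: poly_mapping_eqI simp: lookup_add algebra_simps)

lemma keys_smul: "Poly_Mapping.keys (smul c v) \<subseteq> Poly_Mapping.keys v"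
  by (auto simp: in_keys_iff)

lemma smul_single [simp]: "smul c (Poly_Mapping.single b d) = Poly_Mapping.single b (c * d)"
  by (rule poly_mapping_eqI) (simp add: lookup_single when_def)

lemma lin_superset:
  assumes "finite S" "Poly_Mapping.keys v \<subseteq> S"
  shows "lin f v = (\<Sum>a\<in>S. smul (Poly_Mapping.lookup v a) (f a))"
  unfolding lin_def using assms
  by (intro sum.mono_neutral_left) (auto simp: in_keys_iff)

lemma lin_0 [simp]: "lin f 0 = 0"
  by (simp add: lin_def)

lemma lin_add [simp]: "lin f (v + w) = lin f v + lin f w"
proof -
  let ?S = "Poly_Mapping.keys v \<union> Poly_Mapping.keys w"
  have "Poly_Mapping.keys (v + w) \<subseteq> ?S"
    by (rule Poly_Mapping.keys_add)
  then show ?thesis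
    by (simp add: lin_superset[of ?S] lookup_add fvs.scale_left_distrib sum.distrib)
qed

lemma lin_smul [simp]: "lin f (smul c v) = smul c (lin f v)"
  using keys_smul[of c v]
  by (simp add: lin_superset[of "Poly_Mapping.keys v"] fvs.scale_sum_right)

lemma lin_sum [simp]: "lin f (\<Sum>i\<in>S. v i) = (\<Sum>i\<in>S. lin f (v i))"
  by (induction S rule: infinite_finite_induct) auto

lemma lin_bas [simp]: "lin f (bas a) = f a"
  by (simp add: lin_def)

lemma lin_single [simp]: "lin f (Poly_Mapping.single a c) = smul c (f a)"
  using lin_smul[of f c "bas a"] by (simp del: lin_smul)

lemma lin_uminus [simp]: "lin f (- v) = - lin f v"
  using lin_add[of f v "- v"] by (simp del: lin_add add: eq_neg_iff_add_eq_0 add.commute)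

lemma lin_cong: "(\<And>a. a \<in> Poly_Mapping.keys v \<Longrightarrow> f a = g a) \<Longrightarrow> lin f v = lin g v"
  by (simp add: lin_def)

text \<open>Tells the function package that a recursive call under \<open>lin\<close> happens only
  at keys of the argument; the termination of \<open>conv_right_inverse\<close> depends on
  it.\<close>

lemma lin_fundef_cong [fundef_cong]:
  "v = w \<Longrightarrow> (\<And>a. a \<in> Poly_Mapping.keys w \<Longrightarrow> f a = g a) \<Longrightarrow> lin f v = lin g w"
  by (simp add: lin_def)

lemma lin_lin [simp]: "lin f (lin g v) = lin (\<lambda>a. lin f (g a)) v"
proof -
  have "lin f (lin g v) = (\<Sum>a\<in>Poly_Mapping.keys v. lin f (smul (Poly_Mapping.lookup v a) (g a)))"
    by (simp only: lin_def[of g] lin_sum)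
  then show ?thesis by (simp add: lin_def[of _ v])
qed

lemma lin_fun_add: "lin (\<lambda>a. f a + g a) v = lin f v + lin g v"
  by (simp add: lin_def fvs.scale_right_distrib sum.distrib)

lemma lin_fun_smul: "lin (\<lambda>a. smul c (f a)) v = smul c (lin f v)"
  by (simp add: lin_def fvs.scale_sum_right mult.commute)

lemma lin_fun_0 [simp]: "lin (\<lambda>a. 0) v = 0"
  by (simp add: lin_def)

lemma lin_fun_sum: "lin (\<lambda>a. \<Sum>i\<in>S. f i a) v = (\<Sum>i\<in>S. lin (f i) v)"
  by (induction S rule: infinite_finite_induct) (auto simp: lin_fun_add)

lemma lin_id [simp]: "lin (\<lambda>a. bas a) v = v"
proof (rule poly_mapping_eqI)
  fix b
  have "Poly_Mapping.lookup (lin (\<lambda>a. bas a) v) b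
      = (\<Sum>a\<in>Poly_Mapping.keys v. Poly_Mapping.lookup v a when a = b)"
    unfolding lin_def lookup_sum
    by (intro sum.cong) (auto simp: lookup_single when_def)
  also have "\<dots> = Poly_Mapping.lookup v b"
    by (auto simp: when_def in_keys_iff)
  finally show "Poly_Mapping.lookup (lin (\<lambda>a. bas a) v) b = Poly_Mapping.lookup v b" .
qed

lemma lin_commute: "lin (\<lambda>a. lin (\<lambda>b. f a b) w) v = lin (\<lambda>b. lin (\<lambda>a. f a b) v) w"
  by (simp add: lin_def fvs.scale_sum_right sum.swap[of _ "Poly_Mapping.keys v"] mult.commute)

lemma keys_lin: "Poly_Mapping.keys (lin f v) \<subseteq> (\<Union>a\<in>Poly_Mapping.keys v. Poly_Mapping.keys (f a))"
proof
  fix b assume "b \<in> Poly_Mapping.keys (lin f v)"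
  then have "(\<Sum>a\<in>Poly_Mapping.keys v. Poly_Mapping.lookup v a * Poly_Mapping.lookup (f a) b) \<noteq> 0"
    by (simp add: in_keys_iff lin_def lookup_sum)
  then obtain a where "a \<in> Poly_Mapping.keys v" "Poly_Mapping.lookup v a * Poly_Mapping.lookup (f a) b \<noteq> 0"
    by (meson sum.not_neutral_contains_not_neutral)
  then show "b \<in> (\<Union>a\<in>Poly_Mapping.keys v. Poly_Mapping.keys (f a))"
    by (auto simp: in_keys_iff)
qed

lemma push_0 [simp]: "push h 0 = 0"
  and push_add [simp]: "push h (v + w) = push h v + push h w"
  and push_smul [simp]: "push h (smul c v) = smul c (push h v)"
  and push_bas [simp]: "push h (bas a) = bas (h a)"
  and push_single [simp]: "push h (Poly_Mapping.single a c) = Poly_Mapping.single (h a) c"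
  and push_sum [simp]: "push h (\<Sum>i\<in>S. u i) = (\<Sum>i\<in>S. push h (u i))"
  by (simp_all add: push_def)

lemma lin_push [simp]: "lin f (push h v) = lin (\<lambda>a. f (h a)) v"
  by (simp add: push_def)

lemma push_lin [simp]: "push h (lin f v) = lin (\<lambda>a. push h (f a)) v"
  by (simp add: push_def)

lemma push_push: "push h (push k v) = push (\<lambda>a. h (k a)) v"
  by (simp add: push_def)

lemma keys_push: "Poly_Mapping.keys (push h v) \<subseteq> h ` Poly_Mapping.keys v"
  using keys_lin[of "\<lambda>a. bas (h a)" v] by (auto simp: push_def)

lemma lin_tens [simp]: "lin f (tens v w) = lin (\<lambda>a. lin (\<lambda>b. f (a, b)) w) v"
  by (simp add: tens_def)

lemma tens_bas [simp]: "tens (bas a) (bas b) = bas (a, b)"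
  by (simp add: tens_def)

text \<open>A linear form is a linear map to the line with basis \<open>()\<close>, so the rules for
  \<open>lin\<close> carry over to \<open>lfun\<close>.\<close>

lemma lfun_eq_lin: "lfun f v = Poly_Mapping.lookup (lin (\<lambda>a. Poly_Mapping.single () (f a)) v) ()"
  by (simp add: lfun_def lin_def lookup_sum)

lemma lfun_lin [simp]: "lfun f (lin g v) = lfun (\<lambda>a. lfun f (g a)) v"
proof -
  have "lin (\<lambda>a. Poly_Mapping.single () (f a)) (g b) = Poly_Mapping.single () (lfun f (g b))" for b
    by (rule poly_mapping_eqI) (simp add: lfun_eq_lin)
  then show ?thesis by (simp add: lfun_eq_lin)
qed

lemma lfun_bas [simp]: "lfun f (bas a) = f a"
  by (simp add: lfun_def)

lemma lfun_single [simp]: "lfun f (Poly_Mapping.single a c) = c * f a"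
  by (simp add: lfun_def)

lemma lfun_push [simp]: "lfun f (push h v) = lfun (\<lambda>a. f (h a)) v"
  by (simp add: push_def)

lemma lfun_0 [simp]: "lfun f 0 = 0"
  and lfun_add [simp]: "lfun f (v + w) = lfun f v + lfun f w"
  and lfun_smul [simp]: "lfun f (smul c v) = c * lfun f v"
  by (simp_all add: lfun_eq_lin lookup_add)

lemma lfun_fun_0 [simp]: "lfun (\<lambda>a. 0) v = 0"
  by (simp add: lfun_def)

lemma lfun_mult_left: "lfun (\<lambda>a. c * f a) v = c * lfun f v"
  by (simp add: lfun_def sum_distrib_left algebra_simps)

lemma lfun_mult_right: "lfun (\<lambda>a. f a * c) v = lfun f v * c"
  by (simp add: lfun_def sum_distrib_left algebra_simps)

lemma smul_lfun: "smul (lfun f v) w = lin (\<lambda>a. smul (f a) w) v"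
  by (simp add: lfun_def lin_def fvs.scale_sum_left)

lemma lin_to_single [simp]: "lin (\<lambda>a. Poly_Mapping.single b (f a)) v = Poly_Mapping.single b (lfun f v)"
  using smul_lfun[of f v "bas b"] by simp

section \<open>Subspaces spanned by basis elements\<close>

definition span_keys :: "'b set \<Rightarrow> ('b \<Rightarrow>\<^sub>0 'k::field) set" where
  "span_keys S = {v. Poly_Mapping.keys v \<subseteq> S}"

lemma lin_mem_subspace:
  assumes "module.subspace smul A" "\<And>a. a \<in> Poly_Mapping.keys v \<Longrightarrow> f a \<in> A"
  shows "lin f v \<in> A"
  unfolding lin_def using assms by (intro fvs.subspace_sum fvs.subspace_scale)

lemma subspace_span_keys: "module.subspace smul (span_keys S)"
proof (rule fvs.subspaceI)
  show "v + w \<in> span_keys S" if "v \<in> span_keys S" "w \<in> span_keys S" for v w :: "'b \<Rightarrow>\<^sub>0 'a"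
    using that Poly_Mapping.keys_add[of v w] by (auto simp: span_keys_def)
  show "smul c v \<in> span_keys S" if "v \<in> span_keys S" for c and v :: "'b \<Rightarrow>\<^sub>0 'a"
    using that keys_smul[of c v] by (auto simp: span_keys_def)
qed (simp add: span_keys_def)

lemma push_image_span_keys: "push h ` span_keys S = span_keys (h ` S)"
proof
  show "push h ` span_keys S \<subseteq> span_keys (h ` S)"
    using keys_push[of h] by (fastforce simp: span_keys_def)
  show "span_keys (h ` S) \<subseteq> push h ` span_keys S"
  proof
    fix v assume v: "v \<in> span_keys (h ` S)"
    have "v = lin bas v" by simp
    also have "\<dots> = lin (\<lambda>b. bas (h (inv_into S h b))) v"
      using v by (intro lin_cong) (auto simp: f_inv_into_f span_keys_def)
    also have "\<dots> = push h (push (inv_into S h) v)"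
      by (simp add: push_def)
    finally have "v = push h (push (inv_into S h) v)" .
    moreover have "push (inv_into S h) v \<in> span_keys S"
      using keys_push[of "inv_into S h" v] v inv_into_into[of _ h S] by (fastforce simp: span_keys_def)
    ultimately show "v \<in> push h ` span_keys S" by blast
  qed
qed

lemma UNIV_eq_span_keys: "UNIV = span_keys UNIV"
  by (auto simp: span_keys_def)

lemma span_keys_eq_range_push: "span_keys (range h) = range (push h)"
  by (metis UNIV_eq_span_keys push_image_span_keys)

text \<open>Distinct keys keep distinct images, so no coefficients cancel; formally, pushing back
  along \<open>inv f\<close> recovers \<open>v\<close> and with it every key.\<close>

lemma keys_push_inj:
  assumes "inj f"
  shows "Poly_Mapping.keys (push f v) = f ` Poly_Mapping.keys v"
proof (rule antisym[OF keys_push], rule image_subsetI)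
  fix p assume p: "p \<in> Poly_Mapping.keys v"
  have "push (inv f) (push f v) = v"
    using assms by (simp add: push_push) (simp add: push_def)
  then obtain q where "q \<in> Poly_Mapping.keys (push f v)" "p = inv f q"
    using p keys_push[of "inv f" "push f v"] by auto
  then show "f p \<in> Poly_Mapping.keys (push f v)"
    using keys_push[of f v] assms by (auto simp: inv_f_f)
qed

lemma span_Union_span_keys: "module.span smul (\<Union>i\<in>I. span_keys (S i)) = span_keys (\<Union>i\<in>I. S i)"
proof
  show "module.span smul (\<Union>i\<in>I. span_keys (S i)) \<subseteq> span_keys (\<Union>i\<in>I. S i)"
    by (intro fvs.span_minimal subspace_span_keys) (auto simp: span_keys_def)
  show "span_keys (\<Union>i\<in>I. S i) \<subseteq> module.span smul (\<Union>i\<in>I. span_keys (S i))"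
  proof
    fix v assume v: "v \<in> span_keys (\<Union>i\<in>I. S i)"
    have "lin bas v \<in> module.span smul (\<Union>i\<in>I. span_keys (S i))"
      using v by (intro lin_mem_subspace fvs.subspace_span fvs.span_base) (auto simp: span_keys_def)
    then show "v \<in> module.span smul (\<Union>i\<in>I. span_keys (S i))" by simp
  qed
qed

lemma tensor_space_span_keys:
  "tensor_space (span_keys S) (span_keys T) = (span_keys (S \<times> T) :: ('a \<times> 'b \<Rightarrow>\<^sub>0 'k::field) set)"
proof
  have "tens v w \<in> span_keys (S \<times> T)"
    if "v \<in> span_keys S" "w \<in> span_keys T" for v :: "'a \<Rightarrow>\<^sub>0 'k" and w :: "'b \<Rightarrow>\<^sub>0 'k"
    unfolding tens_def using that
    by (intro lin_mem_subspace subspace_span_keys) (auto simp: span_keys_def)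
  then show "tensor_space (span_keys S) (span_keys T) \<subseteq> (span_keys (S \<times> T) :: ('a \<times> 'b \<Rightarrow>\<^sub>0 'k) set)"
    unfolding tensor_space_def by (intro fvs.span_minimal subspace_span_keys) auto
  show "(span_keys (S \<times> T) :: ('a \<times> 'b \<Rightarrow>\<^sub>0 'k) set) \<subseteq> tensor_space (span_keys S) (span_keys T)"
  proof
    fix v :: "'a \<times> 'b \<Rightarrow>\<^sub>0 'k" assume v: "v \<in> span_keys (S \<times> T)"
    have "lin bas v \<in> tensor_space (span_keys S) (span_keys T)"
    proof (rule lin_mem_subspace)
      show "module.subspace smul (tensor_space (span_keys S) (span_keys T) :: ('a \<times> 'b \<Rightarrow>\<^sub>0 'k) set)"
        by (simp add: tensor_space_def)
      fix p assume "p \<in> Poly_Mapping.keys v"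
      then have p: "fst p \<in> S" "snd p \<in> T" using v by (auto simp: span_keys_def)
      have "tens (bas (fst p)) (bas (snd p)) \<in> tensor_space (span_keys S) (span_keys T :: ('b \<Rightarrow>\<^sub>0 'k) set)"
        unfolding tensor_space_def using p
        by (intro fvs.span_base CollectI exI[of _ "bas (fst p)"] exI[of _ "bas (snd p)"])
          (auto simp: span_keys_def)
      then show "bas p \<in> tensor_space (span_keys S) (span_keys T :: ('b \<Rightarrow>\<^sub>0 'k) set)" by simp
    qed
    then show "v \<in> tensor_space (span_keys S) (span_keys T)" by simp
  qed
qed

section \<open>Hopf algebras with a basis\<close>

text \<open>
  The axioms of a Hopf algebra on basis elements. They are transported along an embedding of the basis
  into the basis of a larger space, which is how a carrier spanned by basis elements arises.
\<close>

locale based_hopf =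
  fixes m :: "'b \<times> 'b \<Rightarrow> ('b \<Rightarrow>\<^sub>0 'k::field)" and one :: 'b
    and D :: "'b \<Rightarrow> ('b \<times> 'b \<Rightarrow>\<^sub>0 'k)" and e :: "'b \<Rightarrow> 'k"
  assumes m_assoc: "lin (\<lambda>z. m (z, w)) (m (u, v)) = lin (\<lambda>z. m (u, z)) (m (v, w))"
    and m_one_left: "m (one, u) = bas u"
    and m_one_right: "m (u, one) = bas u"
    and D_coassoc: "lin (\<lambda>p. lin (\<lambda>a. bas (fst a, snd a, snd p)) (D (fst p))) (D u)
                  = lin (\<lambda>p. lin (\<lambda>a. bas (fst p, fst a, snd a)) (D (snd p))) (D u)"
    and D_counit_left: "lin (\<lambda>p. smul (e (fst p)) (bas (snd p))) (D u) = bas u"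
    and D_counit_right: "lin (\<lambda>p. smul (e (snd p)) (bas (fst p))) (D u) = bas u"
    and D_m: "lin D (m (u, v))
            = lin (\<lambda>p. lin (\<lambda>q. tens (m (fst p, fst q)) (m (snd p, snd q))) (D v)) (D u)"
    and D_one: "D one = bas (one, one)"
    and e_m: "lfun e (m (u, v)) = e u * e v"
    and e_one: "e one = 1"
    and antipode_ex: "\<exists>S. \<forall>u.
          lin (\<lambda>p. lin (\<lambda>a. m (a, snd p)) (S (fst p))) (D u) = smul (e u) (bas one) \<and>
          lin (\<lambda>p. lin (\<lambda>a. m (fst p, a)) (S (snd p))) (D u) = smul (e u) (bas one)"
begin

text \<open>The structure maps of \<open>B\<close> are prescribed only on \<open>range emb\<close>:
  their values at other basis elements, such as \<open>Word []\<close> or words that are not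
  composable, never reach the carrier.\<close>

theorem hopf_algebra_along_embedding:
  fixes emb :: "'b \<Rightarrow> 'c" and B :: "('c, 'k) hopf"
  assumes inj: "inj emb"
    and carrier: "hcarrier B = span_keys (range emb)"
    and mult: "\<And>u v. hmult B (emb u, emb v) = push emb (m (u, v))"
    and unit: "hunit B = bas (emb one)"
    and comult: "\<And>u. hcomult B (emb u) = push (\<lambda>p. (emb (fst p), emb (snd p))) (D u)"
    and counit: "\<And>u. hcounit B (emb u) = e u"
  shows "is_hopf_algebra B"
proof -
  note simps = push_def tmap_def case_prod_unfold assoc_tens_def comult mult counit unit
  have carr: "hcarrier B = range (push emb)"
    by (simp add: carrier span_keys_eq_range_push)
  have sub: "module.subspace smul (hcarrier B)"
    by (simp add: carrier subspace_span_keys)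
  have algebra: "is_algebra B"
    unfolding is_algebra_def Let_def
  proof (intro conjI ballI sub)
    show "hunit B \<in> hcarrier B"
      unfolding carr unit by (metis push_bas rangeI)
    fix x y assume "x \<in> hcarrier B" "y \<in> hcarrier B"
    then obtain v w where xy: "x = push emb v" "y = push emb w" by (auto simp: carr)
    have "lin (hmult B) (tens x y) = push emb (lin (\<lambda>a. lin (\<lambda>b. m (a, b)) w) v)"
      by (simp add: simps xy)
    then show "lin (hmult B) (tens x y) \<in> hcarrier B" unfolding carr by (metis rangeI)
    fix z assume "z \<in> hcarrier B"
    then obtain u where z: "z = push emb u" by (auto simp: carr)
    \<comment> \<open>The axiom is wrapped in the linear extensions before simplification, because
      the monad laws fuse nested \<open>lin\<close>s and the bare axiom would no longer match. The
      same device recurs below.\<close>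
    have "push emb (lin (\<lambda>a. lin (\<lambda>b. lin (\<lambda>c. lin (\<lambda>z. m (z, c)) (m (a, b))) u) w) v)
        = push emb (lin (\<lambda>a. lin (\<lambda>b. lin (\<lambda>c. lin (\<lambda>z. m (a, z)) (m (b, c))) u) w) v)"
      by (simp only: m_assoc)
    then show "lin (hmult B) (tens (lin (hmult B) (tens x y)) z)
             = lin (hmult B) (tens x (lin (hmult B) (tens y z)))"
      by (simp add: simps xy z lin_commute[of _ u])
  qed (auto simp: carr simps m_one_left m_one_right)
  have coalgebra: "is_coalgebra B"
    unfolding is_coalgebra_def Let_def
  proof (intro conjI ballI sub)
    fix x assume "x \<in> hcarrier B"
    then obtain v where x: "x = push emb v" by (auto simp: carr)
    have "lin (hcomult B) x = push (\<lambda>p. (emb (fst p), emb (snd p))) (lin D v)"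
      by (simp add: simps x)
    moreover have "range (\<lambda>p. (emb (fst p), emb (snd p))) = range emb \<times> range emb"
      by (auto simp: image_def)
    ultimately show "lin (hcomult B) x \<in> tensor_space (hcarrier B) (hcarrier B)"
      unfolding carrier tensor_space_span_keys
      by (metis rangeI span_keys_eq_range_push)
    have "lin (\<lambda>t. bas (emb (fst t), emb (fst (snd t)), emb (snd (snd t))))
              (lin (\<lambda>p. lin (\<lambda>a. bas (fst a, snd a, snd p)) (D (fst p))) (D u))
        = lin (\<lambda>t. bas (emb (fst t), emb (fst (snd t)), emb (snd (snd t))))
              (lin (\<lambda>p. lin (\<lambda>a. bas (fst p, fst a, snd a)) (D (snd p))) (D u))" for u
      by (simp only: D_coassoc)
    then show "assoc_tens (lin (tmap (hcomult B) bas) (lin (hcomult B) x))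
             = lin (tmap bas (hcomult B)) (lin (hcomult B) x)"
      by (simp add: simps x tens_def)
    have "push emb (lin (\<lambda>p. smul (e (fst p)) (bas (snd p))) (D u)) = bas (emb u)" for u
      by (simp only: D_counit_left push_bas)
    then show "lin (\<lambda>(a, b). smul (hcounit B a) (bas b)) (lin (hcomult B) x) = x"
      by (simp add: simps x)
    have "push emb (lin (\<lambda>p. smul (e (snd p)) (bas (fst p))) (D u)) = bas (emb u)" for u
      by (simp only: D_counit_right push_bas)
    then show "lin (\<lambda>(a, b). smul (hcounit B b) (bas a)) (lin (hcomult B) x) = x"
      by (simp add: simps x)
  qed
  have bialgebra: "is_bialgebra B"
    unfolding is_bialgebra_def Let_def
  proof (intro conjI ballI algebra coalgebra)
    fix x y assume "x \<in> hcarrier B" "y \<in> hcarrier B"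
    then obtain v w where xy: "x = push emb v" "y = push emb w" by (auto simp: carr)
    have "push (\<lambda>p. (emb (fst p), emb (snd p))) (lin D (m (a, b)))
        = push (\<lambda>p. (emb (fst p), emb (snd p)))
            (lin (\<lambda>p. lin (\<lambda>q. tens (m (fst p, fst q)) (m (snd p, snd q))) (D b)) (D a))" for a b
      by (simp only: D_m)
    then show "lin (hcomult B) (lin (hmult B) (tens x y)) =
          lin (tmap (hmult B) (hmult B)) (lin (tensor_comult (hcomult B)) (tens x y))"
      by (simp add: simps xy tensor_comult_def tens_def)
    have "lfun e (lin (\<lambda>a. lin (\<lambda>b. m (a, b)) w) v) = lfun e v * lfun e w"
      by (simp add: e_m lfun_mult_left lfun_mult_right)
    then show "lfun (hcounit B) (lin (hmult B) (tens x y)) = lfun (hcounit B) x * lfun (hcounit B) y"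
      by (simp add: simps xy)
  qed (simp_all add: simps D_one e_one)
  obtain S where S:
    "\<And>u. lin (\<lambda>p. lin (\<lambda>a. m (a, snd p)) (S (fst p))) (D u) = smul (e u) (bas one)"
    "\<And>u. lin (\<lambda>p. lin (\<lambda>a. m (fst p, a)) (S (snd p))) (D u) = smul (e u) (bas one)"
    using antipode_ex by blast
  define S' where "S' = (\<lambda>x. push emb (S (inv emb x)))"
  have S': "S' (emb u) = push emb (S u)" for u
    by (simp add: S'_def inj)
  have "lin S' x \<in> hcarrier B \<and>
        lin (hmult B) (lin (tmap S' bas) (lin (hcomult B) x)) = smul (lfun (hcounit B) x) (hunit B) \<and>
        lin (hmult B) (lin (tmap bas S') (lin (hcomult B) x)) = smul (lfun (hcounit B) x) (hunit B)"
    if mem: "x \<in> hcarrier B" for x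
  proof -
    obtain v where x: "x = push emb v" using mem unfolding carr by blast
    have "lin S' x = push emb (lin S v)"
      by (simp add: x S')
    then have "lin S' x \<in> hcarrier B"
      unfolding carr by (metis rangeI)
    moreover have "push emb (lin (\<lambda>p. lin (\<lambda>a. m (a, snd p)) (S (fst p))) (D u)) = smul (e u) (bas (emb one))"
      and "push emb (lin (\<lambda>p. lin (\<lambda>a. m (fst p, a)) (S (snd p))) (D u)) = smul (e u) (bas (emb one))" for u
      by (simp_all only: S push_smul push_bas)
    ultimately show ?thesis
      by (simp add: simps x S' smul_lfun tens_def)
  qed
  with bialgebra show ?thesis
    unfolding is_hopf_algebra_def by blast
qed

end

section \<open>Quasi-shuffle products\<close>

text \<open>
  The letters \<open>x\<close> form a basis of the coinvariants of a Hopf bimodule over the group algebra of \<open>'g\<close>;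
  the left and right actions of \<open>g\<close> on the generator \<open>x\<close> are multiplication by \<open>L g x\<close> and
  \<open>R g x\<close>, up to a shift of the group element, and \<open>\<alpha>\<close> sends a pair of letters to a multiple of a letter.
\<close>

locale quasi_shuffle =
  fixes deg :: "'x \<Rightarrow> 'g::ab_group_add"
    and L R :: "'g \<Rightarrow> 'x \<Rightarrow> 'k::field"
    and t :: "'x \<Rightarrow> 'x \<Rightarrow> 'k" and a :: "'x \<Rightarrow> 'x \<Rightarrow> 'x"
  assumes L_add: "L (g + h) x = L g x * L h x" and L_0: "L 0 x = 1"
    and R_add: "R (g + h) x = R g x * R h x" and R_0: "R 0 x = 1"
    and deg_a: "t x y \<noteq> 0 \<Longrightarrow> deg (a x y) = deg x + deg y"
    and L_a: "t x y \<noteq> 0 \<Longrightarrow> L g (a x y) = L g x * L g y"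
    and R_a: "t x y \<noteq> 0 \<Longrightarrow> R g (a x y) = R g x * R g y"
    and t_nilpotent: "t x y \<noteq> 0 \<Longrightarrow> t (a x y) z = 0" "t y z \<noteq> 0 \<Longrightarrow> t x (a y z) = 0"
begin

definition wt :: "'x list \<Rightarrow> 'g" where "wt xs = sum_list (map deg xs)"
definition Lw :: "'g \<Rightarrow> 'x list \<Rightarrow> 'k" where "Lw g xs = prod_list (map (L g) xs)"
definition Rw :: "'g \<Rightarrow> 'x list \<Rightarrow> 'k" where "Rw g xs = prod_list (map (R g) xs)"

lemma wt_simps [simp]: "wt [] = 0" "wt (x # xs) = deg x + wt xs" "wt (xs @ ys) = wt xs + wt ys"
  by (simp_all add: wt_def)

lemma Lw_simps [simp]: "Lw g [] = 1" "Lw g (x # xs) = L g x * Lw g xs" "Lw g (xs @ ys) = Lw g xs * Lw g ys"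
  by (simp_all add: Lw_def)

lemma Rw_simps [simp]: "Rw g [] = 1" "Rw g (x # xs) = R g x * Rw g xs" "Rw g (xs @ ys) = Rw g xs * Rw g ys"
  by (simp_all add: Rw_def)

lemma Lw_add: "Lw (g + h) xs = Lw g xs * Lw h xs" and Lw_0 [simp]: "Lw 0 xs = 1"
  by (induction xs) (simp_all add: L_add L_0)

lemma Rw_add: "Rw (g + h) xs = Rw g xs * Rw h xs" and Rw_0 [simp]: "Rw 0 xs = 1"
  by (induction xs) (simp_all add: R_add R_0)

text \<open>The scalars are those of the two actions and of \<alpha> on first letters when both
  words have right end 0: the group element at the left end of what remains of one word acts on the
  first letter of the other. \<open>qmul\<close> restores arbitrary right ends through
  \<open>Lw\<close> and \<open>Rw\<close>.\<close>

fun prd :: "'x list \<Rightarrow> 'x list \<Rightarrow> ('x list \<Rightarrow>\<^sub>0 'k)" where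
  "prd [] ys = bas ys"
| "prd (x # xs) [] = bas (x # xs)"
| "prd (x # xs) (y # ys) =
     smul (R (wt (y # ys)) x) (push ((#) x) (prd xs (y # ys))) +
     smul (L (wt (x # xs)) y) (push ((#) y) (prd (x # xs) ys)) +
     smul (L (wt xs) y * R (wt ys) x * t x y) (push ((#) (a x y)) (prd xs ys))"

lemma prd_Nil_right [simp]: "prd xs [] = bas xs"
  by (cases xs) auto

text \<open>Merging letters respects degrees and characters. Scalars that depend on a term of the
  product are therefore constant and can be pulled out of \<open>lin\<close>.\<close>

lemma keys_prd:
  "zs \<in> Poly_Mapping.keys (prd xs ys) \<Longrightarrow>
     wt zs = wt xs + wt ys \<and> Lw g zs = Lw g xs * Lw g ys \<and> Rw g zs = Rw g xs * Rw g ys"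
proof (induction xs ys arbitrary: zs rule: prd.induct)
  case (3 x xs y ys)
  have "zs \<in> (#) x ` Poly_Mapping.keys (prd xs (y # ys)) \<or>
        zs \<in> (#) y ` Poly_Mapping.keys (prd (x # xs) ys) \<or>
        t x y \<noteq> 0 \<and> zs \<in> (#) (a x y) ` Poly_Mapping.keys (prd xs ys)"
    using "3.prems" unfolding prd.simps
    by (cases "t x y = 0")
       (auto dest!: subsetD[OF Poly_Mapping.keys_add] subsetD[OF keys_smul] subsetD[OF keys_push]
             simp del: push_smul)
  then show ?case
    using "3.IH" deg_a L_a R_a by (fastforce simp: algebra_simps)
qed auto

definition mul :: "('x list \<Rightarrow>\<^sub>0 'k) \<Rightarrow> ('x list \<Rightarrow>\<^sub>0 'k) \<Rightarrow> ('x list \<Rightarrow>\<^sub>0 'k)" where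
  "mul v w = lin (\<lambda>xs. lin (\<lambda>ys. prd xs ys) w) v"

definition lcons :: "'x \<Rightarrow> ('x list \<Rightarrow>\<^sub>0 'k) \<Rightarrow> ('x list \<Rightarrow>\<^sub>0 'k)" where
  "lcons x v = push ((#) x) v"

definition homogeneous :: "'g \<Rightarrow> ('x list \<Rightarrow>\<^sub>0 'k) \<Rightarrow> bool" where
  "homogeneous n v \<longleftrightarrow> (\<forall>zs\<in>Poly_Mapping.keys v. wt zs = n)"

lemma mul_linear [simp]:
  "mul (v + v') w = mul v w + mul v' w" "mul (smul c v) w = smul c (mul v w)"
  "mul v (w + w') = mul v w + mul v w'" "mul v (smul c w) = smul c (mul v w)"
  by (simp_all add: mul_def lin_fun_add lin_fun_smul)

lemma lcons_linear [simp]: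
  "lcons x (v + w) = lcons x v + lcons x w" "lcons x (smul c v) = smul c (lcons x v)"
  by (simp_all add: lcons_def)

lemma mul_bas [simp]: "mul (bas xs) (bas ys) = prd xs ys"
  by (simp add: mul_def)

lemma lcons_bas: "lcons x (bas xs) = bas (x # xs)"
  by (simp add: lcons_def)

lemma homogeneous_bas: "homogeneous (wt xs) (bas xs)"
  by (simp add: homogeneous_def)

lemma homogeneous_prd: "homogeneous (wt xs + wt ys) (prd xs ys)"
  using keys_prd by (auto simp: homogeneous_def)

text \<open>The recursion for \<open>prd\<close> extends to linear combinations only when they are
  homogeneous, because its scalars depend on the degrees of the tails.\<close>

lemma mul_lcons:
  assumes "homogeneous n v" "homogeneous k w"
  shows "mul (lcons x v) (lcons y w) =
     smul (R (deg y + k) x) (lcons x (mul v (lcons y w))) +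
     smul (L (deg x + n) y) (lcons y (mul (lcons x v) w)) +
     smul (L n y * R k x * t x y) (lcons (a x y) (mul v w))"
proof -
  have "mul (lcons x v) (lcons y w) = lin (\<lambda>xs. lin (\<lambda>ys. prd (x # xs) (y # ys)) w) v"
    by (simp add: mul_def lcons_def)
  also have "\<dots> = lin (\<lambda>xs. lin (\<lambda>ys.
       smul (R (deg y + k) x) (push ((#) x) (prd xs (y # ys))) +
       smul (L (deg x + n) y) (push ((#) y) (prd (x # xs) ys)) +
       smul (L n y * R k x * t x y) (push ((#) (a x y)) (prd xs ys))) w) v"
    using assms by (intro lin_cong) (simp add: homogeneous_def)
  finally show ?thesis
    by (simp add: lin_fun_add lin_fun_smul mul_def lcons_def)
qed

text \<open>Both bracketings are sorted by the first letter of the result: x, y, z or a merge of two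
  of them, since merges of three vanish by \<open>t_nilpotent\<close>. Each of the six classes
  carries a product of a shorter triple, and these are the six instances collected in
  \<open>IH\<close>.\<close>

lemma mul_assoc_bas: "mul (prd xs ys) (bas zs) = mul (bas xs) (prd ys zs)"
proof (induction "length xs + length ys + length zs" arbitrary: xs ys zs rule: less_induct)
  case less
  show ?case
  proof (cases "xs = [] \<or> ys = [] \<or> zs = []")
    case True
    moreover have "prd [] = (\<lambda>ys. bas ys)" by (rule ext) simp
    ultimately show ?thesis by (auto simp: mul_def)
  next
    case False
    then obtain x xs' y ys' z zs' where eq: "xs = x # xs'" "ys = y # ys'" "zs = z # zs'"
      by (meson neq_Nil_conv)
    define u v w :: "'x list \<Rightarrow>\<^sub>0 'k" where "u = bas xs'" and "v = bas ys'" and "w = bas zs'"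
    define X Y Z :: "'x list \<Rightarrow>\<^sub>0 'k" where "X = bas xs" and "Y = bas ys" and "Z = bas zs"
    define k m n where "k = wt xs'" and "m = wt ys'" and "n = wt zs'"
    have cons: "X = lcons x u" "Y = lcons y v" "Z = lcons z w"
      by (simp_all add: X_def Y_def Z_def u_def v_def w_def eq lcons_bas)
    note defs = u_def v_def w_def X_def Y_def Z_def
    have IH: "mul (mul u Y) Z = mul u (mul Y Z)" "mul (mul X v) Z = mul X (mul v Z)"
      "mul (mul u v) Z = mul u (mul v Z)" "mul (mul X Y) w = mul X (mul Y w)"
      "mul (mul u Y) w = mul u (mul Y w)" "mul (mul X v) w = mul X (mul v w)"
      using less[of xs' ys zs] less[of xs ys' zs] less[of xs' ys' zs] less[of xs ys zs']
        less[of xs' ys zs'] less[of xs ys' zs']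
      by (simp_all add: defs eq)
    have hom: "homogeneous k u" "homogeneous m v" "homogeneous n w"
      "homogeneous (k + (deg y + m)) (mul u Y)" "homogeneous (deg x + k + m) (mul X v)"
      "homogeneous (k + m) (mul u v)" "homogeneous (m + (deg z + n)) (mul v Z)"
      "homogeneous (deg y + m + n) (mul Y w)" "homogeneous (m + n) (mul v w)"
      using homogeneous_prd[of xs' ys] homogeneous_prd[of xs ys'] homogeneous_prd[of xs' ys']
        homogeneous_prd[of ys' zs] homogeneous_prd[of ys zs'] homogeneous_prd[of ys' zs']
      by (simp_all add: defs k_def m_def n_def homogeneous_bas) (simp_all add: eq)
    have XY: "mul X Y = smul (R (deg y + m) x) (lcons x (mul u Y))
        + smul (L (deg x + k) y) (lcons y (mul X v))
        + smul (L k y * R m x * t x y) (lcons (a x y) (mul u v))"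
      using mul_lcons[OF hom(1,2)] by (simp add: cons)
    have YZ: "mul Y Z = smul (R (deg z + n) y) (lcons y (mul v Z))
        + smul (L (deg y + m) z) (lcons z (mul Y w))
        + smul (L m z * R n y * t y z) (lcons (a y z) (mul v w))"
      using mul_lcons[OF hom(2,3)] by (simp add: cons)
    \<comment> \<open>The three summands of \<open>XY\<close> each contribute a term beginning with
      z, with the same scalar; together they give back \<open>mul X Y\<close>. In
      \<open>right\<close> the terms beginning with x recombine likewise into
      \<open>mul Y Z\<close>.\<close>
    have left: "mul (mul X Y) Z =
        smul (R (deg y + m) x * R (deg z + n) x) (lcons x (mul (mul u Y) Z))
      + smul (L (deg x + k) y * R (deg z + n) y) (lcons y (mul (mul X v) Z))
      + smul (L k y * R m x * t x y * (R (deg z + n) x * R (deg z + n) y)) (lcons (a x y) (mul (mul u v) Z))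
      + smul (L (deg x + k + (deg y + m)) z) (lcons z (mul (mul X Y) w))
      + smul (R (deg y + m) x * R n x * L (k + (deg y + m)) z * t x z) (lcons (a x z) (mul (mul u Y) w))
      + smul (L (deg x + k) y * R n y * L (deg x + k + m) z * t y z) (lcons (a y z) (mul (mul X v) w))"
      using mul_lcons[OF hom(4,3), of x z] mul_lcons[OF hom(5,3), of y z] mul_lcons[OF hom(6,3), of "a x y" z]
      by (cases "t x y = 0")
         (simp_all add: XY cons(3)[symmetric] t_nilpotent R_a L_a deg_a fvs.scale_right_distrib ac_simps)
    have right: "mul X (mul Y Z) =
        smul (R (deg y + m + (deg z + n)) x) (lcons x (mul u (mul Y Z)))
      + smul (R (deg z + n) y * L (deg x + k) y) (lcons y (mul X (mul v Z)))
      + smul (R (deg z + n) y * L k y * R (m + (deg z + n)) x * t x y) (lcons (a x y) (mul u (mul v Z)))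
      + smul (L (deg y + m) z * L (deg x + k) z) (lcons z (mul X (mul Y w)))
      + smul (L (deg y + m) z * L k z * R (deg y + m + n) x * t x z) (lcons (a x z) (mul u (mul Y w)))
      + smul (L m z * R n y * t y z * (L (deg x + k) y * L (deg x + k) z)) (lcons (a y z) (mul X (mul v w)))"
      using mul_lcons[OF hom(1,7), of x y] mul_lcons[OF hom(1,8), of x z] mul_lcons[OF hom(1,9), of x "a y z"]
      by (cases "t y z = 0")
         (simp_all add: YZ cons(1)[symmetric] t_nilpotent R_a L_a deg_a fvs.scale_right_distrib ac_simps)
    have "mul (mul X Y) Z = mul X (mul Y Z)"
      unfolding left right IH by (simp add: L_add R_add ac_simps)
    then show ?thesis by (simp add: defs)
  qed
qed

lemma prd_assoc: "lin (\<lambda>z. prd z zs) (prd xs ys) = lin (\<lambda>z. prd xs z) (prd ys zs)"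
  using mul_assoc_bas[of xs ys zs] by (simp add: mul_def)

section \<open>Deconcatenation and its compatibility with the product\<close>

primrec cut :: "'x list \<Rightarrow> ('x list \<times> 'x list \<Rightarrow>\<^sub>0 'k)" where
  "cut [] = bas ([], [])"
| "cut (x # xs) = bas ([], x # xs) + push (\<lambda>p. (x # fst p, snd p)) (cut xs)"

lemma keys_cut: "p \<in> Poly_Mapping.keys (cut xs) \<Longrightarrow> xs = fst p @ snd p"
proof (induction xs arbitrary: p)
  case (Cons x xs)
  then show ?case
    by (auto dest!: subsetD[OF Poly_Mapping.keys_add] subsetD[OF keys_push])
qed simp

lemma cut_coassoc:
  "lin (\<lambda>p. lin (\<lambda>a. bas (fst a, snd a, snd p)) (cut (fst p))) (cut xs)
 = lin (\<lambda>p. lin (\<lambda>a. bas (fst p, fst a, snd a)) (cut (snd p))) (cut xs)"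
proof (induction xs)
  case (Cons x xs)
  have "lin (\<lambda>s. bas (x # fst s, snd s)) (lin (\<lambda>p. lin (\<lambda>a. bas (fst a, snd a, snd p)) (cut (fst p))) (cut xs))
      = lin (\<lambda>s. bas (x # fst s, snd s)) (lin (\<lambda>p. lin (\<lambda>a. bas (fst p, fst a, snd a)) (cut (snd p))) (cut xs))"
    by (simp only: Cons.IH)
  then show ?case
    by (simp add: lin_fun_add)
qed simp

lemma cut_counit:
  "lin (\<lambda>p. if fst p = [] then bas (snd p) else 0) (cut xs) = bas xs"
  "lin (\<lambda>p. if snd p = [] then bas (fst p) else 0) (cut xs) = bas xs"
proof -
  show "lin (\<lambda>p. if fst p = [] then bas (snd p) else 0) (cut xs) = bas xs"
    by (cases xs) simp_all
  show "lin (\<lambda>p. if snd p = [] then bas (fst p) else 0) (cut xs) = bas xs"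
  proof (induction xs)
    case (Cons x xs)
    then have "lin (\<lambda>ys. bas (x # ys)) (lin (\<lambda>p. if snd p = [] then bas (fst p) else 0) (cut xs)) = bas (x # xs)"
      by simp
    then show ?case by (simp add: if_distrib[of "lin _"] cong: if_cong)
  qed simp
qed

text \<open>Cutting leaves the degrees of the right parts as group elements at the right ends of the
  left parts, where each acts on the letters of the other left part; this is the origin of the
  scalar.\<close>

definition cut_product :: "'x list \<Rightarrow> 'x list \<Rightarrow> ('x list \<times> 'x list \<Rightarrow>\<^sub>0 'k)" where
  "cut_product xs ys = lin (\<lambda>p. lin (\<lambda>p'.
      smul (Lw (wt (snd p)) (fst p') * Rw (wt (snd p')) (fst p))
        (tens (prd (fst p) (fst p')) (prd (snd p) (snd p')))) (cut ys)) (cut xs)"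

text \<open>The pairs of cuts of \<open>x # xs\<close> and \<open>y # ys\<close> fall into four
  classes, according to which left parts are empty. The equations \<open>e0\<close> to
  \<open>e3\<close> match them with the cuts of the three summands of the recursion for
  \<open>prd\<close>.\<close>

lemma cut_prd: "lin cut (prd xs ys) = cut_product xs ys"
proof (induction xs ys rule: prd.induct)
  case (1 ys)
  have "lin (\<lambda>p. bas (fst p, snd p)) (cut ys) = cut ys" by simp
  then show ?case by (simp add: cut_product_def)
next
  case (2 x xs)
  have "lin (\<lambda>p. bas (x # fst p, snd p)) (cut xs) = push (\<lambda>p. (x # fst p, snd p)) (cut xs)"
    by (simp add: push_def)
  then show ?case by (simp add: cut_product_def)
next
  case (3 x xs y ys)
  define pre where "pre z = (push (\<lambda>p. (z # fst p, snd p)) :: ('x list \<times> 'x list \<Rightarrow>\<^sub>0 'k) \<Rightarrow> _)" for z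
  define emp where "emp = (push (Pair ([] :: 'x list)) :: ('x list \<Rightarrow>\<^sub>0 'k) \<Rightarrow> _)"
  define c d where "c p p' = Lw (wt (snd p)) (fst p') * Rw (wt (snd p')) (fst p)"
    and "d p p' = tens (prd (fst p) (fst p')) (prd (snd p) (snd p'))" for p p'
  let ?u = "x # xs" and ?v = "y # ys"
  let ?x = "\<lambda>p. (x # fst p, snd p)" and ?y = "\<lambda>p. (y # fst p, snd p)"
  note linear = lin_fun_add lin_fun_smul fvs.scale_right_distrib
  have pre: "pre z (v + w) = pre z v + pre z w" "pre z (smul s v) = smul s (pre z v)"
    "pre z (lin f v') = lin (\<lambda>i. pre z (f i)) v'"
    for z s v w and f :: "_ \<Rightarrow> _" and v' :: "('x list \<times> 'x list) \<Rightarrow>\<^sub>0 'k"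
    by (simp_all add: pre_def)
  have tens: "tens (push ((#) z) v) w = pre z (tens v w)" "tens (bas (z # zs)) w = pre z (tens (bas zs) w)"
    for z zs v and w :: "'x list \<Rightarrow>\<^sub>0 'k"
    by (simp_all add: pre_def tens_def)
  have tens_linear: "tens (v + w) w' = tens v w' + tens w w'" "tens (smul s v) w' = smul s (tens v w')"
    for s and v w w' :: "'x list \<Rightarrow>\<^sub>0 'k"
    by (simp_all add: tens_def)
  have step: "lin cut (push ((#) z) v) = emp (push ((#) z) v) + pre z (lin cut v)" for z v
    by (simp add: emp_def pre_def lin_fun_add) (simp add: push_def)
  have emp_linear: "emp (v + w) = emp v + emp w" "emp (smul s v) = smul s (emp v)" for s v w
    by (simp_all add: emp_def)
  have "lin cut (prd ?u ?v) = emp (prd ?u ?v)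
      + smul (R (wt ?v) x) (pre x (cut_product xs ?v))
      + smul (L (wt ?u) y) (pre y (cut_product ?u ys))
      + smul (L (wt xs) y * R (wt ys) x * t x y) (pre (a x y) (cut_product xs ys))"
    using 3 by (cases "t x y = 0") (simp_all add: step emp_linear linear del: lin_push push_def wt_simps)
  also have "emp (prd ?u ?v) = d ([], ?u) ([], ?v)"
    by (simp add: emp_def d_def tens_def del: prd.simps) (simp add: push_def del: prd.simps)
  also have "cut_product xs ?v = lin (\<lambda>p. smul (c p ([], ?v)) (d p ([], ?v))) (cut xs)
      + lin (\<lambda>p. lin (\<lambda>p'. smul (c p (?y p')) (d p (?y p'))) (cut ys)) (cut xs)"
    by (simp add: cut_product_def c_def d_def lin_fun_add)
  also have "cut_product ?u ys = lin (\<lambda>p'. smul (c ([], ?u) p') (d ([], ?u) p')) (cut ys)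
      + lin (\<lambda>p. lin (\<lambda>p'. smul (c (?x p) p') (d (?x p) p')) (cut ys)) (cut xs)"
    by (simp add: cut_product_def c_def d_def lin_fun_add)
  also have "cut_product xs ys = lin (\<lambda>p. lin (\<lambda>p'. smul (c p p') (d p p')) (cut ys)) (cut xs)"
    by (simp add: cut_product_def c_def d_def)
  finally have lhs: "lin cut (prd ?u ?v) = d ([], ?u) ([], ?v)
      + lin (\<lambda>p. smul (R (wt ?v) x) (pre x (smul (c p ([], ?v)) (d p ([], ?v))))) (cut xs)
      + lin (\<lambda>p'. smul (L (wt ?u) y) (pre y (smul (c ([], ?u) p') (d ([], ?u) p')))) (cut ys)
      + lin (\<lambda>p. lin (\<lambda>p'.
            smul (R (wt ?v) x) (pre x (smul (c p (?y p')) (d p (?y p'))))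
          + smul (L (wt ?u) y) (pre y (smul (c (?x p) p') (d (?x p) p')))
          + smul (L (wt xs) y * R (wt ys) x * t x y) (pre (a x y) (smul (c p p') (d p p')))) (cut ys)) (cut xs)"
    by (simp only: pre(1,3) linear ac_simps)
  have rhs: "cut_product ?u ?v = smul (c ([], ?u) ([], ?v)) (d ([], ?u) ([], ?v))
      + lin (\<lambda>p. smul (c (?x p) ([], ?v)) (d (?x p) ([], ?v))) (cut xs)
      + lin (\<lambda>p'. smul (c ([], ?u) (?y p')) (d ([], ?u) (?y p'))) (cut ys)
      + lin (\<lambda>p. lin (\<lambda>p'. smul (c (?x p) (?y p')) (d (?x p) (?y p'))) (cut ys)) (cut xs)"
    by (simp add: cut_product_def c_def[symmetric] d_def[symmetric] lin_fun_add ac_simps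
        del: prd.simps wt_simps Lw_simps Rw_simps)
  have e0: "smul (c ([], ?u) ([], ?v)) (d ([], ?u) ([], ?v)) = d ([], ?u) ([], ?v)"
    by (simp add: c_def)
  have e1: "smul (c (?x p) ([], ?v)) (d (?x p) ([], ?v))
      = smul (R (wt ?v) x) (pre x (smul (c p ([], ?v)) (d p ([], ?v))))" for p
    by (simp add: c_def d_def tens pre)
  have e2: "smul (c ([], ?u) (?y p')) (d ([], ?u) (?y p'))
      = smul (L (wt ?u) y) (pre y (smul (c ([], ?u) p') (d ([], ?u) p')))" for p'
    by (simp add: c_def d_def tens pre)
  \<comment> \<open>With both left parts nonempty, expanding their product by the recursion yields
    three summands. Their scalars agree because the degree of a word is the sum of the degrees of
    the two parts of any of its cuts.\<close>
  have e3: "lin (\<lambda>p. lin (\<lambda>p'. smul (c (?x p) (?y p')) (d (?x p) (?y p'))) (cut ys)) (cut xs)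
      = lin (\<lambda>p. lin (\<lambda>p'.
            smul (R (wt ?v) x) (pre x (smul (c p (?y p')) (d p (?y p'))))
          + smul (L (wt ?u) y) (pre y (smul (c (?x p) p') (d (?x p) p')))
          + smul (L (wt xs) y * R (wt ys) x * t x y) (pre (a x y) (smul (c p p') (d p p')))) (cut ys)) (cut xs)"
  proof (intro lin_cong)
    fix p p' assume "p \<in> Poly_Mapping.keys (cut xs)" "p' \<in> Poly_Mapping.keys (cut ys)"
    then have "xs = fst p @ snd p" "ys = fst p' @ snd p'"
      by (simp_all add: keys_cut)
    then have wt: "wt xs = wt (fst p) + wt (snd p)" "wt ys = wt (fst p') + wt (snd p')"
      by (metis wt_simps(3))+
    show "smul (c (?x p) (?y p')) (d (?x p) (?y p')) =
            smul (R (wt ?v) x) (pre x (smul (c p (?y p')) (d p (?y p'))))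
          + smul (L (wt ?u) y) (pre y (smul (c (?x p) p') (d (?x p) p')))
          + smul (L (wt xs) y * R (wt ys) x * t x y) (pre (a x y) (smul (c p p') (d p p')))"
      by (simp add: c_def d_def tens tens_linear pre wt L_add R_add fvs.scale_right_distrib ac_simps)
  qed
  show ?case unfolding lhs rhs e3 by (simp only: e0 e1 e2)
qed

end

section \<open>The Hopf algebra of words\<close>

context quasi_shuffle
begin

text \<open>
  The basis element \<open>(xs, g)\<close> stands for the composable word with letters \<open>xs\<close> and right degree \<open>g\<close>;
  its left degree is \<open>wt xs + g\<close>.
\<close>

definition left_deg :: "'x list \<times> 'g \<Rightarrow> 'g" where
  "left_deg u = wt (fst u) + snd u"

definition qmul :: "('x list \<times> 'g) \<times> ('x list \<times> 'g) \<Rightarrow> ('x list \<times> 'g \<Rightarrow>\<^sub>0 'k)" where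
  "qmul = (\<lambda>(u, v). smul (Lw (snd u) (fst v) * Rw (snd v) (fst u))
     (push (\<lambda>zs. (zs, snd u + snd v)) (prd (fst u) (fst v))))"

definition decon :: "'x list \<times> 'g \<Rightarrow> (('x list \<times> 'g) \<times> ('x list \<times> 'g) \<Rightarrow>\<^sub>0 'k)" where
  "decon u = push (\<lambda>p. ((fst p, wt (snd p) + snd u), (snd p, snd u))) (cut (fst u))"

definition qcounit :: "'x list \<times> 'g \<Rightarrow> 'k" where
  "qcounit u = (if fst u = [] then 1 else 0)"

text \<open>By \<open>keys_prd\<close> the scalars of either bracketing are constant along the terms
  of the inner product. They collect into the same \<open>c\<close>, and \<open>prd_assoc\<close>
  remains.\<close>

lemma qmul_assoc: "lin (\<lambda>z. qmul (z, w)) (qmul (u, v)) = lin (\<lambda>z. qmul (u, z)) (qmul (v, w))"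
proof -
  obtain xs g ys h zs k where eq: "u = (xs, g)" "v = (ys, h)" "w = (zs, k)"
    by (metis surj_pair)
  define c where "c = Lw g ys * Rw h xs * Lw (g + h) zs * Rw k xs * Rw k ys"
  have "lin (\<lambda>z. qmul (z, w)) (qmul (u, v))
      = smul (Lw g ys * Rw h xs) (lin (\<lambda>z. smul (Lw (g + h) zs * Rw k z)
          (push (\<lambda>s. (s, g + h + k)) (prd z zs))) (prd xs ys))"
    by (simp add: qmul_def eq)
  also have "lin (\<lambda>z. smul (Lw (g + h) zs * Rw k z) (push (\<lambda>s. (s, g + h + k)) (prd z zs))) (prd xs ys)
      = lin (\<lambda>z. smul (Lw (g + h) zs * Rw k xs * Rw k ys) (push (\<lambda>s. (s, g + h + k)) (prd z zs))) (prd xs ys)"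
    by (intro lin_cong) (simp add: keys_prd)
  also have "smul (Lw g ys * Rw h xs) \<dots> = smul c (push (\<lambda>s. (s, g + h + k)) (lin (\<lambda>z. prd z zs) (prd xs ys)))"
    by (simp add: lin_fun_smul c_def ac_simps)
  also have "\<dots> = smul c (push (\<lambda>s. (s, g + h + k)) (lin (\<lambda>z. prd xs z) (prd ys zs)))"
    by (simp only: prd_assoc)
  also have "\<dots> = smul (Lw h zs * Rw k ys) (lin (\<lambda>z. smul (Lw g ys * Lw g zs * Rw (h + k) xs)
      (push (\<lambda>s. (s, g + h + k)) (prd xs z))) (prd ys zs))"
    by (simp add: lin_fun_smul c_def Lw_add Rw_add ac_simps)
  also have "lin (\<lambda>z. smul (Lw g ys * Lw g zs * Rw (h + k) xs) (push (\<lambda>s. (s, g + h + k)) (prd xs z))) (prd ys zs)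
      = lin (\<lambda>z. smul (Lw g z * Rw (h + k) xs) (push (\<lambda>s. (s, g + h + k)) (prd xs z))) (prd ys zs)"
    by (intro lin_cong) (simp add: keys_prd)
  also have "smul (Lw h zs * Rw k ys) \<dots> = lin (\<lambda>z. qmul (u, z)) (qmul (v, w))"
    by (simp add: qmul_def eq add.assoc)
  finally show ?thesis .
qed

lemma qmul_unit [simp]: "qmul (([], 0), u) = bas u" "qmul (u, ([], 0)) = bas u"
  by (simp_all add: qmul_def)

lemma qmul_group: "qmul (([], g), ([], h)) = bas ([], g + h)"
  by (simp add: qmul_def)

lemma decon_Nil: "decon ([], g) = bas (([], g), ([], g))"
  by (simp add: decon_def)

lemma decon_Cons: "decon (x # xs, g) = bas (([], left_deg (x # xs, g)), (x # xs, g))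
   + lin (\<lambda>p. bas ((x # fst p, wt (snd p) + g), (snd p, g))) (cut xs)"
  by (simp add: decon_def left_deg_def) (simp add: push_def)

lemma decon_coassoc:
  "lin (\<lambda>p. lin (\<lambda>s. bas (fst s, snd s, snd p)) (decon (fst p))) (decon u)
 = lin (\<lambda>p. lin (\<lambda>s. bas (fst p, fst s, snd s)) (decon (snd p))) (decon u)"
proof -
  obtain xs g where u: "u = (xs, g)" by (metis surj_pair)
  define h :: "_ \<Rightarrow> _ \<Rightarrow>\<^sub>0 'k" where "h s = bas ((fst s, wt (fst (snd s)) + wt (snd (snd s)) + g),
      (fst (snd s), wt (snd (snd s)) + g), (snd (snd s), g))" for s :: "'x list \<times> 'x list \<times> 'x list"
  have "lin (\<lambda>p. lin (\<lambda>s. bas (fst s, snd s, snd p)) (decon (fst p))) (decon u)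
      = lin h (lin (\<lambda>p. lin (\<lambda>a. bas (fst a, snd a, snd p)) (cut (fst p))) (cut xs))"
    by (simp add: decon_def u h_def add.assoc)
  also have "\<dots> = lin (\<lambda>p. lin (\<lambda>a. h (fst p, fst a, snd a)) (cut (snd p))) (cut xs)"
    by (simp add: cut_coassoc)
  also have "\<dots> = lin (\<lambda>p. lin (\<lambda>a. bas ((fst p, wt (snd p) + g), (fst a, wt (snd a) + g), (snd a, g)))
      (cut (snd p))) (cut xs)"
  proof (intro lin_cong)
    fix p s :: "'x list \<times> 'x list" assume "s \<in> Poly_Mapping.keys (cut (snd p))"
    then have "wt (snd p) = wt (fst s) + wt (snd s)"
      by (metis keys_cut wt_simps(3))
    then show "h (fst p, fst s, snd s) = bas ((fst p, wt (snd p) + g), (fst s, wt (snd s) + g), (snd s, g))"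
      by (simp add: h_def)
  qed
  also have "\<dots> = lin (\<lambda>p. lin (\<lambda>s. bas (fst p, fst s, snd s)) (decon (snd p))) (decon u)"
    by (simp add: decon_def u)
  finally show ?thesis .
qed

text \<open>A map that is blind to left factors of positive degree sees a single cut, the one
  splitting off the group element at the left end. This evaluates counits and, later, forms
  concentrated in degree 0.\<close>

lemma lin_decon_left_group:
  assumes "\<And>x xs g v. h ((x # xs, g), v) = 0"
  shows "lin h (decon u) = h (([], left_deg u), u)"
proof -
  obtain xs g where u: "u = (xs, g)" by (metis surj_pair)
  show ?thesis
    by (cases xs) (simp_all add: u decon_Nil decon_Cons assms left_deg_def)
qed

lemma lin_decon_right_group:
  assumes "\<And>x xs g v. h (v, (x # xs, g)) = 0"
  shows "lin h (decon u) = h (u, ([], snd u))"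
proof -
  obtain xs g where u: "u = (xs, g)" by (metis surj_pair)
  have h: "h (v, (xs, k)) = (if xs = [] then h (v, ([], k)) else 0)" for v xs k
    by (cases xs) (simp_all add: assms)
  have "lin h (decon u) = lin (\<lambda>p. if snd p = [] then h ((fst p, g), ([], g)) else 0) (cut xs)"
    by (simp add: decon_def u h[of _ "snd _"]) (intro lin_cong; simp)
  also have "\<dots> = lin (\<lambda>s. h ((s, g), ([], g))) (lin (\<lambda>p. if snd p = [] then bas (fst p) else 0) (cut xs))"
    by (simp add: if_distrib[of "lin _"] cong: if_cong)
  also have "\<dots> = h (u, ([], snd u))"
    by (simp only: cut_counit lin_bas u snd_conv)
  finally show ?thesis .
qed

lemma decon_counit:
  "lin (\<lambda>p. smul (qcounit (fst p)) (bas (snd p))) (decon u) = bas u"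
  "lin (\<lambda>p. smul (qcounit (snd p)) (bas (fst p))) (decon u) = bas u"
  by (subst lin_decon_left_group lin_decon_right_group; simp add: qcounit_def)+

lemma qcounit_qmul: "lfun qcounit (qmul (u, v)) = qcounit u * qcounit v"
proof -
  obtain xs g ys h where "u = (xs, g)" "v = (ys, h)" by (metis surj_pair)
  then show ?thesis
    by (cases xs; cases ys) (simp_all add: qmul_def qcounit_def)
qed

lemma decon_qmul:
  "lin decon (qmul (u, v))
 = lin (\<lambda>p. lin (\<lambda>q. tens (qmul (fst p, fst q)) (qmul (snd p, snd q))) (decon v)) (decon u)"
proof -
  obtain xs g ys h where eq: "u = (xs, g)" "v = (ys, h)" by (metis surj_pair)
  define c where "c = Lw g ys * Rw h xs"
  \<comment> \<open>On terms of a product the degree of the right part is known, so the group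
    element read off each term is replaced by the fixed \<open>n + g + h\<close>.\<close>
  define emb where "emb n = (\<lambda>r :: 'x list \<times> 'x list. ((fst r, n + g + h), (snd r, g + h)))" for n
  have emb: "push (\<lambda>r. ((fst r, wt (snd r) + g + h), (snd r, g + h))) (tens (prd a b) (prd a' b'))
      = push (emb (wt a' + wt b')) (tens (prd a b) (prd a' b'))" for a b a' b'
    unfolding push_def by (simp add: emb_def) (intro lin_cong; simp add: keys_prd)
  have "lin decon (qmul (u, v))
      = smul c (push (\<lambda>r. ((fst r, wt (snd r) + g + h), (snd r, g + h))) (lin cut (prd xs ys)))"
    by (simp add: qmul_def eq decon_def c_def add.assoc)
  also have "\<dots> = smul c (lin (\<lambda>p. lin (\<lambda>p'. smul (Lw (wt (snd p)) (fst p') * Rw (wt (snd p')) (fst p))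
        (push (emb (wt (snd p) + wt (snd p'))) (tens (prd (fst p) (fst p')) (prd (snd p) (snd p'))))) (cut ys)) (cut xs))"
    by (simp only: cut_prd cut_product_def push_lin push_smul emb)
  also have "\<dots> = lin (\<lambda>p. lin (\<lambda>p'. smul (c * (Lw (wt (snd p)) (fst p') * Rw (wt (snd p')) (fst p)))
        (push (emb (wt (snd p) + wt (snd p'))) (tens (prd (fst p) (fst p')) (prd (snd p) (snd p'))))) (cut ys)) (cut xs)"
    by (simp only: lin_fun_smul[symmetric] fvs.scale_scale)
  also have "\<dots> = lin (\<lambda>p. lin (\<lambda>q. tens (qmul (fst p, fst q)) (qmul (snd p, snd q))) (decon v)) (decon u)"
    unfolding decon_def lin_push
  proof (simp only: eq fst_conv snd_conv, intro lin_cong)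
    fix p q assume "p \<in> Poly_Mapping.keys (cut xs)" "q \<in> Poly_Mapping.keys (cut ys)"
    then have pq: "xs = fst p @ snd p" "ys = fst q @ snd q"
      by (simp_all add: keys_cut)
    have c: "c = Lw g (fst q) * Lw g (snd q) * (Rw h (fst p) * Rw h (snd p))"
      unfolding c_def by (subst pq(1), subst pq(2)) simp
    have tens: "tens (smul r v) w = smul r (tens v w)" "tens v (smul r w) = smul r (tens v w)"
      for r and v w :: "'x list \<times> 'g \<Rightarrow>\<^sub>0 'k"
      by (simp_all add: tens_def lin_fun_smul)
    have "tens (push (\<lambda>zs. (zs, k)) v) (push (\<lambda>zs. (zs, l)) w) = push (\<lambda>r. ((fst r, k), (snd r, l))) (tens v w)"
      for k l :: 'g and v w :: "'x list \<Rightarrow>\<^sub>0 'k"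
      by (simp add: tens_def)
    then show "smul (c * (Lw (wt (snd p)) (fst q) * Rw (wt (snd q)) (fst p)))
        (push (emb (wt (snd p) + wt (snd q))) (tens (prd (fst p) (fst q)) (prd (snd p) (snd q))))
      = tens (qmul ((fst p, wt (snd p) + g), (fst q, wt (snd q) + h))) (qmul ((snd p, g), (snd q, h)))"
      by (simp add: qmul_def tens emb_def c Lw_add Rw_add ac_simps)
  qed
  finally show ?thesis .
qed

subsection \<open>The antipode\<close>

definition conv :: "('x list \<times> 'g \<Rightarrow> ('x list \<times> 'g \<Rightarrow>\<^sub>0 'k)) \<Rightarrow> ('x list \<times> 'g \<Rightarrow> ('x list \<times> 'g \<Rightarrow>\<^sub>0 'k))
    \<Rightarrow> 'x list \<times> 'g \<Rightarrow> ('x list \<times> 'g \<Rightarrow>\<^sub>0 'k)" where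
  "conv f h u = lin (\<lambda>p. lin (\<lambda>c. lin (\<lambda>d. qmul (c, d)) (h (snd p))) (f (fst p))) (decon u)"

definition conv_unit :: "'x list \<times> 'g \<Rightarrow> ('x list \<times> 'g \<Rightarrow>\<^sub>0 'k)" where
  "conv_unit u = smul (qcounit u) (bas ([], 0))"

lemma conv_assoc: "conv (conv f h) k u = conv f (conv h k) u"
proof -
  define F where "F s = lin (\<lambda>b. lin (\<lambda>c. lin (\<lambda>d. lin (\<lambda>z. qmul (z, d)) (qmul (b, c)))
      (k (snd (snd s)))) (h (fst (snd s)))) (f (fst s))" for s
  have "conv (conv f h) k u = lin F (lin (\<lambda>p. lin (\<lambda>s. bas (fst s, snd s, snd p)) (decon (fst p))) (decon u))"
    by (simp add: conv_def F_def lin_commute[of _ "k _" "qmul _"])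
  also have "\<dots> = lin F (lin (\<lambda>p. lin (\<lambda>s. bas (fst p, fst s, snd s)) (decon (snd p))) (decon u))"
    by (simp only: decon_coassoc)
  also have "\<dots> = conv f (conv h k) u"
    by (simp add: conv_def F_def qmul_assoc lin_commute[of _ "decon _" "f _"])
  finally show ?thesis .
qed

lemma conv_unit_left [simp]: "conv conv_unit f u = f u"
  by (simp add: conv_def conv_unit_def qcounit_def) (subst lin_decon_left_group; simp)

lemma conv_unit_right [simp]: "conv f conv_unit u = f u"
  by (simp add: conv_def conv_unit_def qcounit_def) (subst lin_decon_right_group; simp)

text \<open>The recursion solves \<open>conv f h u = conv_unit u\<close> for the summand containing \<open>h u\<close>.\<close>

function conv_right_inverse ::
    "('x list \<times> 'g \<Rightarrow> ('x list \<times> 'g \<Rightarrow>\<^sub>0 'k)) \<Rightarrow> ('g \<Rightarrow> 'g) \<Rightarrow> 'x list \<times> 'g \<Rightarrow> ('x list \<times> 'g \<Rightarrow>\<^sub>0 'k)" where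
  "conv_right_inverse f \<gamma> ([], g) = bas ([], - \<gamma> g)"
| "conv_right_inverse f \<gamma> (x # xs, g) = - lin (\<lambda>b. qmul (([], - \<gamma> (left_deg (x # xs, g))), b))
     (lin (\<lambda>p. lin (\<lambda>c. lin (\<lambda>d. qmul (c, d)) (conv_right_inverse f \<gamma> (snd p, g)))
       (f (x # fst p, wt (snd p) + g))) (cut xs))"
  by pat_completeness auto
termination
proof (relation "measure (\<lambda>(f, \<gamma>, u). length (fst u))", goal_cases)
  case (2 f \<gamma> x xs g p)
  then have "length xs = length (fst p) + length (snd p)"
    by (metis keys_cut length_append)
  then show ?case by simp
qed simp

text \<open>The generality in \<open>f\<close> and \<gamma> allows two applications: to the
  identity, and then to the resulting inverse, which negates group elements.\<close>

lemma conv_right_inverse: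
  assumes "\<And>g. f ([], g) = bas ([], \<gamma> g)"
  shows "conv f (conv_right_inverse f \<gamma>) u = conv_unit u"
proof -
  obtain xs g where u: "u = (xs, g)" by (metis surj_pair)
  show ?thesis
  proof (cases xs)
    case Nil
    then show ?thesis
      by (simp add: u conv_def decon_Nil assms conv_unit_def qcounit_def qmul_group)
  next
    case (Cons x xs')
    define v where "v = lin (\<lambda>p. lin (\<lambda>c. lin (\<lambda>d. qmul (c, d)) (conv_right_inverse f \<gamma> (snd p, g)))
       (f (x # fst p, wt (snd p) + g))) (cut xs')"
    \<comment> \<open>Multiplication by the group element \<open>k\<close> undoes multiplication by
      \<open>- k\<close>. The cut with empty left part thus contributes \<open>- v\<close>, and all
      other cuts together contribute \<open>v\<close>.\<close>
    have cancel: "lin (\<lambda>z. qmul (([], k), z)) (qmul (([], - k), b)) = bas b" for k b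
      using qmul_assoc[of b "([], k)" "([], - k)"] by (simp add: qmul_group)
    have "conv_right_inverse f \<gamma> (x # xs', g) = - lin (\<lambda>b. qmul (([], - \<gamma> (left_deg (x # xs', g))), b)) v"
      by (simp add: v_def)
    then have "conv f (conv_right_inverse f \<gamma>) (x # xs', g) = 0"
      by (simp add: conv_def decon_Cons assms cancel v_def[symmetric] del: conv_right_inverse.simps)
    then show ?thesis
      by (simp add: u Cons conv_unit_def qcounit_def)
  qed
qed

text \<open>
  A right convolution inverse \<open>S\<close> of the identity has itself a right inverse \<open>T\<close>, and
  associativity forces \<open>T\<close> to be the identity.
\<close>

lemma antipode_exists:
  "\<exists>S. \<forall>u. conv S (\<lambda>u. bas u) u = conv_unit u \<and> conv (\<lambda>u. bas u) S u = conv_unit u"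
proof -
  define S where "S = conv_right_inverse (\<lambda>u. bas u) (\<lambda>g. g)"
  define T where "T = conv_right_inverse S uminus"
  have S: "conv (\<lambda>u. bas u) S = conv_unit"
    unfolding S_def by (rule ext, rule conv_right_inverse) simp
  have T: "conv S T = conv_unit"
    unfolding T_def by (rule ext, rule conv_right_inverse) (simp add: S_def)
  have "T u = conv (conv (\<lambda>u. bas u) S) T u" for u
    by (simp add: S)
  then have "T = (\<lambda>u. bas u)"
    by (simp add: conv_assoc T fun_eq_iff)
  with S T show ?thesis by (intro exI[of _ S]) simp
qed

sublocale based_hopf qmul "([], 0)" decon qcounit
proof
  show "\<exists>S. \<forall>u. lin (\<lambda>p. lin (\<lambda>a. qmul (a, snd p)) (S (fst p))) (decon u) = smul (qcounit u) (bas ([], 0)) \<and>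
        lin (\<lambda>p. lin (\<lambda>a. qmul (fst p, a)) (S (snd p))) (decon u) = smul (qcounit u) (bas ([], 0))"
    using antipode_exists by (simp add: conv_def conv_unit_def)
qed (simp_all only: qmul_assoc decon_coassoc decon_counit decon_Nil qcounit_qmul decon_qmul qmul_unit,
    simp add: qcounit_def)

end

section \<open>The cotensor coalgebra and its quasi-symmetric product\<close>

text \<open>M and its twist both have this form, with different characters on the same basis. The
  scalars in \<open>alpha\<close> are forced by the value \<open>t x y\<close> at group elements 0,
  as \<alpha> is right linear and balanced over H.\<close>

locale quasi_shuffle_bimod = quasi_shuffle deg L R t a
  for deg :: "'x \<Rightarrow> 'g::ab_group_add" and L R :: "'g \<Rightarrow> 'x \<Rightarrow> 'k::field"
    and t :: "'x \<Rightarrow> 'x \<Rightarrow> 'k" and a :: "'x \<Rightarrow> 'x \<Rightarrow> 'x" +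
  fixes M :: "('g, 'x \<times> 'g, 'k) bimod"
    and \<alpha> :: "('x \<times> 'g) \<times> ('x \<times> 'g) \<Rightarrow> ('x \<times> 'g \<Rightarrow>\<^sub>0 'k)"
  assumes lcoact: "lcoact M = (\<lambda>m. bas (deg (fst m) + snd m, m))"
    and rcoact: "rcoact M = (\<lambda>m. bas (m, snd m))"
    and lact: "lact M (h, (x, k)) = smul (L h x) (bas (x, h + k))"
    and ract: "ract M ((x, k), h) = smul (R h x) (bas (x, k + h))"
    and alpha: "\<alpha> ((x, k), (y, l)) = smul (L k y * R l x * t x y) (bas (a x y, k + l))"
begin

section \<open>Composable words as a basis of the cotensor coalgebra\<close>

primrec path :: "'x list \<Rightarrow> 'g \<Rightarrow> ('x \<times> 'g) list" where
  "path [] g = []"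
| "path (x # xs) g = (x, wt xs + g) # path xs g"

definition emb :: "'x list \<times> 'g \<Rightarrow> ('g, 'x \<times> 'g) word" where
  "emb u = (if fst u = [] then Grp (snd u) else Word (path (fst u) (snd u)))"

lemma emb_simps [simp]: "emb ([], g) = Grp g" "emb (x # xs, g) = Word ((x, wt xs + g) # path xs g)"
  by (simp_all add: emb_def)

lemma map_fst_path [simp]: "map fst (path xs g) = xs"
  by (induction xs) auto

lemma length_path [simp]: "length (path xs g) = length xs"
  by (metis length_map map_fst_path)

lemma path_eq_Nil_iff [simp]: "path xs g = [] \<longleftrightarrow> xs = []"
  by (cases xs) auto

lemma last_path: "xs \<noteq> [] \<Longrightarrow> snd (last (path xs g)) = g"
  by (induction xs) auto

lemma hd_path: "xs \<noteq> [] \<Longrightarrow> deg (fst (hd (path xs g))) + snd (hd (path xs g)) = wt xs + g"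
  by (cases xs) (auto simp: add.assoc)

lemma take_path: "take i (path xs g) = path (take i xs) (wt (drop i xs) + g)"
proof (induction xs arbitrary: i)
  case (Cons x xs)
  have "wt xs = wt (take i xs) + wt (drop i xs)" for i
    by (metis append_take_drop_id wt_simps(3))
  with Cons show ?case by (cases i) (auto simp: add.assoc)
qed simp

lemma drop_path: "drop i (path xs g) = path (drop i xs) g"
proof (induction xs arbitrary: i)
  case (Cons x xs)
  then show ?case by (cases i) auto
qed simp

lemma inj_emb: "inj emb"
proof (rule injI)
  fix u v assume uv: "emb u = emb v"
  show "u = v"
  proof (cases "fst u = [] \<or> fst v = []")
    case True
    with uv show ?thesis by (auto simp: emb_def prod_eq_iff split: if_splits)
  next
    case False
    with uv have "path (fst u) (snd u) = path (fst v) (snd v)"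
      by (simp add: emb_def)
    with False show ?thesis
      by (metis last_path map_fst_path prod_eq_iff)
  qed
qed

definition paths :: "nat \<Rightarrow> ('x \<times> 'g) list set" where
  "paths n = {path xs g | xs g. length xs = n}"

lemma paths_Suc: "paths (Suc n) = (\<lambda>p. fst p # snd p) ` {((x, wt xs + g), path xs g) | x xs g. length xs = n}"
  unfolding paths_def by (auto simp: length_Suc_conv image_iff) (metis path.simps(2))+

text \<open>Both coactions send basis elements to basis elements, and differ only in the group
  element they insert in the middle. Hence the kernel condition holds key by key, where it says that
  the right degree of the new letter is the left degree of the path.\<close>

lemma cotensor_paths:
  assumes "n > 0"
  shows "cotensor (rcoact M) (lcoact_list (lcoact M)) UNIV (span_keys (paths n))
       = span_keys {((x, wt xs + g), path xs g) | x xs g. length xs = n}"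
    (is "_ = span_keys ?S")
proof -
  define f where "f p = (fst p, snd (fst p), snd p)" for p :: "('x \<times> 'g) \<times> ('x \<times> 'g) list"
  define h where "h p = (fst p, deg (fst (hd (snd p))) + snd (hd (snd p)), snd p)"
    for p :: "('x \<times> 'g) \<times> ('x \<times> 'g) list"
  have "inj f" by (auto simp: inj_def f_def)
  have S: "?S = {p \<in> UNIV \<times> paths n. f p = h p}"
    using assms by (auto simp: paths_def f_def h_def hd_path) (metis length_0_conv less_numeral_extra(3) hd_path)+
  have "v \<in> cotensor (rcoact M) (lcoact_list (lcoact M)) UNIV (span_keys (paths n)) \<longleftrightarrow> v \<in> span_keys ?S"
    if v: "v \<in> span_keys (UNIV \<times> paths n)" for v :: "('x \<times> 'g) \<times> ('x \<times> 'g) list \<Rightarrow>\<^sub>0 'k"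
  proof -
    have "assoc_tens (lin (tmap (rcoact M) bas) v) = push f v"
      by (simp add: rcoact assoc_tens_def tmap_def case_prod_unfold f_def push_def)
    moreover have "lin (tmap bas (lcoact_list (lcoact M))) v = push h v"
      unfolding push_def
    proof (rule lin_cong)
      fix p assume "p \<in> Poly_Mapping.keys v"
      then have "snd p \<noteq> []" using v assms by (auto simp: span_keys_def paths_def)
      then show "tmap bas (lcoact_list (lcoact M)) p = bas (h p)"
        by (cases "snd p") (auto simp: lcoact_list_def lcoact tmap_def case_prod_unfold h_def)
    qed
    ultimately have "v \<in> cotensor (rcoact M) (lcoact_list (lcoact M)) UNIV (span_keys (paths n))
        \<longleftrightarrow> push f v = push h v"
      using v by (simp add: cotensor_def UNIV_eq_span_keys[where 'a = "'x \<times> 'g"] tensor_space_span_keys)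
    also have "\<dots> \<longleftrightarrow> (\<forall>p\<in>Poly_Mapping.keys v. f p = h p)"
    proof
      assume eq: "push f v = push h v"
      show "\<forall>p\<in>Poly_Mapping.keys v. f p = h p"
      proof
        fix p assume "p \<in> Poly_Mapping.keys v"
        then have "f p \<in> Poly_Mapping.keys (push h v)"
          unfolding eq[symmetric] keys_push_inj[OF \<open>inj f\<close>] by blast
        \<comment> \<open>Both \<open>f\<close> and \<open>h\<close> keep the outer components, so
          \<open>f p = h q\<close> already forces \<open>p = q\<close>.\<close>
        from subsetD[OF keys_push this] obtain q where "f p = h q" by blast
        then show "f p = h p" by (auto simp: f_def h_def prod_eq_iff)
      qed
    qed (auto simp: push_def intro: lin_cong)
    also have "\<dots> \<longleftrightarrow> v \<in> span_keys ?S"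
      using v unfolding S by (auto simp: span_keys_def)
    finally show ?thesis .
  qed
  moreover have "v \<in> span_keys (UNIV \<times> paths n)" if "v \<in> span_keys ?S" for v :: "('x \<times> 'g) \<times> ('x \<times> 'g) list \<Rightarrow>\<^sub>0 'k"
    using that unfolding S by (auto simp: span_keys_def)
  moreover have "v \<in> span_keys (UNIV \<times> paths n)"
    if "v \<in> cotensor (rcoact M) (lcoact_list (lcoact M)) UNIV (span_keys (paths n))" for v
    using that by (simp add: cotensor_def UNIV_eq_span_keys[where 'a = "'x \<times> 'g"] tensor_space_span_keys)
  ultimately show ?thesis by blast
qed

lemma cotensor_power_paths: "cotensor_power M n = span_keys (paths (Suc n))"
proof (induction n)
  case 0
  have "range (\<lambda>m. [m]) = paths (Suc 0)"
  proof (intro antisym image_subsetI subsetI)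
    show "[m] \<in> paths (Suc 0)" for m
      unfolding paths_def by (intro CollectI exI[of _ "[fst m]"] exI[of _ "snd m"]) simp
  qed (auto simp: paths_def length_Suc_conv)
  then show ?case
    by (simp add: UNIV_eq_span_keys[where 'a = "'x \<times> 'g"] push_image_span_keys)
next
  case (Suc n)
  then show ?case
    unfolding cotensor_power.simps Suc.IH
    by (subst cotensor_paths) (auto simp: push_image_span_keys case_prod_unfold paths_Suc[of "Suc n"])
qed

lemma cotensor_carrier_eq: "cotensor_carrier M = span_keys (range emb)"
proof -
  have "range emb = range Grp \<union> (\<Union>n. Word ` paths (Suc n))"
  proof (intro antisym image_subsetI Un_least UN_least subsetI)
    show "emb u \<in> range Grp \<union> (\<Union>n. Word ` paths (Suc n))" for u
    proof (cases "fst u")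
      case Nil
      then show ?thesis by (simp add: emb_def)
    next
      case (Cons x xs)
      then have "path (fst u) (snd u) \<in> paths (Suc (length xs))"
        unfolding paths_def by (intro CollectI exI[of _ "fst u"] exI[of _ "snd u"]) simp
      with Cons show ?thesis by (auto simp: emb_def)
    qed
    show "Grp g \<in> range emb" for g
      by (metis emb_simps(1) rangeI)
    show "Word ms \<in> range emb" if ms: "ms \<in> paths (Suc n)" for n ms
    proof -
      obtain xs g where "length xs = Suc n" "ms = path xs g"
        using ms by (auto simp: paths_def)
      then have "Word ms = emb (xs, g)" by (auto simp: emb_def)
      then show ?thesis by simp
    qed
  qed
  \<comment> \<open>The index \<open>None\<close> stands for degree 0, which turns all degrees into
    one indexed union.\<close>
  also have "\<dots> = (\<Union>i::nat option. case i of None \<Rightarrow> range Grp | Some n \<Rightarrow> Word ` paths (Suc n))"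
    by (auto simp: UNIV_option_conv)
  finally have rng: "range emb = (\<Union>i::nat option. case i of None \<Rightarrow> range Grp | Some n \<Rightarrow> Word ` paths (Suc n))" .
  show ?thesis
    unfolding rng span_Union_span_keys[symmetric] cotensor_carrier_def
    by (rule arg_cong[of _ _ "module.span smul"])
       (auto simp: UNIV_option_conv cotensor_power_paths push_image_span_keys span_keys_eq_range_push)
qed

lemma cut_eq_sum: "cut xs = (\<Sum>i\<le>length xs. bas (take i xs, drop i xs))"
  by (induction xs) (simp_all add: sum.atMost_Suc_shift del: sum.atMost_Suc)

lemma word_comult_emb: "word_comult M (emb u) = push (\<lambda>p. (emb (fst p), emb (snd p))) (decon u)"
proof -
  obtain xs g where u: "u = (xs, g)" by (metis surj_pair)
  show ?thesis
  proof (cases "xs = []")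
    case True
    then show ?thesis by (simp add: u word_comult_def decon_Nil)
  next
    case False
    let ?ms = "path xs g" and ?n = "length xs"
    let ?b = "\<lambda>i. bas (emb (take i xs, wt (drop i xs) + g), emb (drop i xs, g))"
    \<comment> \<open>The cuts at the two ends are the summands given by the coactions, and the
      interior cuts are the plain deconcatenations.\<close>
    have "{..?n} = insert 0 (insert ?n {1..<?n})" "?n \<noteq> 0"
      using False by auto
    then have "(\<Sum>i\<le>?n. ?b i) = ?b 0 + ((\<Sum>i\<in>{1..<?n}. ?b i) + ?b ?n)"
      by (simp add: add.commute)
    also have "(\<Sum>i\<in>{1..<?n}. ?b i) = (\<Sum>i\<in>{1..<?n}. bas (Word (take i ?ms), Word (drop i ?ms)))"
      using False by (intro sum.cong) (auto simp: emb_def take_path drop_path)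
    finally have "(\<Sum>i\<le>?n. ?b i) = word_comult M (emb u)"
      using False by (simp add: u word_comult_def lcoact rcoact emb_def hd_path last_path add.assoc)
    moreover have "push (\<lambda>p. (emb (fst p), emb (snd p))) (decon u) = (\<Sum>i\<le>?n. ?b i)"
      by (simp only: u decon_def cut_eq_sum push_push push_sum push_bas fst_conv snd_conv)
    ultimately show ?thesis by simp
  qed
qed

text \<open>The \<open>n\<close>-th summand of the quasi-symmetric product, with \<open>n\<close> counted from 0.\<close>

definition piece :: "nat \<Rightarrow> ('g, 'x \<times> 'g) word \<times> ('g, 'x \<times> 'g) word \<Rightarrow> (('x \<times> 'g) list \<Rightarrow>\<^sub>0 'k)" where
  "piece n d = lin (tensor_power_map (qs_f M \<alpha>)) (iter_comult (tensor_comult (word_comult M)) n d)"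

definition cons_tens :: "('x \<times> 'g \<Rightarrow>\<^sub>0 'k) \<Rightarrow> (('x \<times> 'g) list \<Rightarrow>\<^sub>0 'k) \<Rightarrow> (('x \<times> 'g) list \<Rightarrow>\<^sub>0 'k)" where
  "cons_tens v w = lin (\<lambda>m. lin (\<lambda>ms. bas (m # ms)) w) v"

lemma cons_tens_simps [simp]: "cons_tens 0 w = 0" "cons_tens v 0 = 0"
  "cons_tens (smul c v) w = smul c (cons_tens v w)" "cons_tens v (smul c w) = smul c (cons_tens v w)"
  by (simp_all add: cons_tens_def lin_fun_smul)

lemma cons_tens_single: "cons_tens (Poly_Mapping.single m c) w = smul c (push ((#) m) w)"
  by (simp add: cons_tens_def push_def)

lemma piece_0: "piece 0 d = push (\<lambda>m. [m]) (qs_f M \<alpha> d)"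
  by (simp add: piece_def case_prod_unfold) (simp add: push_def)

lemma piece_Suc: "piece (Suc n) d =
    lin (\<lambda>p. cons_tens (qs_f M \<alpha> (fst p)) (piece n (snd p))) (tensor_comult (word_comult M) d)"
proof -
  have [simp]: "tensor_power_map (qs_f M \<alpha>) (b # ds)
      = cons_tens (qs_f M \<alpha> b) (tensor_power_map (qs_f M \<alpha>) ds)" for b ds
    by (simp add: cons_tens_def case_prod_unfold push_def)
  have "lin (\<lambda>ds. cons_tens v (tensor_power_map (qs_f M \<alpha>) ds)) w
      = cons_tens v (lin (tensor_power_map (qs_f M \<alpha>)) w)" for v w
    by (simp add: cons_tens_def lin_commute[of _ w v])
  then show ?thesis
    by (simp add: piece_def tmap_def case_prod_unfold del: tensor_power_map.simps(2))
qed

lemma piece_Suc_emb: "piece (Suc n) (emb u, emb v) =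
    lin (\<lambda>p. lin (\<lambda>q. cons_tens (qs_f M \<alpha> (emb (fst p), emb (fst q))) (piece n (emb (snd p), emb (snd q))))
      (decon v)) (decon u)"
  by (simp add: piece_Suc tensor_comult_def word_comult_emb case_prod_unfold)

lemma qs_f_emb:
  "qs_f M \<alpha> (emb ([], g), emb ([], h)) = 0"
  "qs_f M \<alpha> (emb ([], g), emb ([y], h)) = smul (L g y) (bas (y, g + h))"
  "qs_f M \<alpha> (emb ([x], g), emb ([], h)) = smul (R h x) (bas (x, g + h))"
  "qs_f M \<alpha> (emb ([x], g), emb ([y], h)) = smul (L g y * R h x * t x y) (bas (a x y, g + h))"
  "qs_f M \<alpha> (emb (x # x' # xs, g), w) = 0"
  "qs_f M \<alpha> (w, emb (y # y' # ys, h)) = 0"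
  by (simp_all add: qs_f_def lact ract alpha split: word.split list.split)

text \<open>\<open>qs_f\<close> vanishes as soon as one argument has more than one letter, so only
  cuts with at most one letter on the left contribute.\<close>

lemma lin_decon_short:
  assumes "\<And>x x' xs g v. h ((x # x' # xs, g), v) = 0"
  shows "lin h (decon ([], g)) = h (([], g), ([], g))"
    and "lin h (decon (x # xs, g)) = h (([], wt (x # xs) + g), (x # xs, g)) + h (([x], wt xs + g), (xs, g))"
proof -
  have "lin (\<lambda>p. h ((x # fst p, wt (snd p) + g), (snd p, g))) (cut xs) = h (([x], wt xs + g), (xs, g))"
    by (cases xs) (simp_all add: assms)
  then show "lin h (decon (x # xs, g)) = h (([], wt (x # xs) + g), (x # xs, g)) + h (([x], wt xs + g), (xs, g))"
    by (simp add: decon_Cons left_deg_def)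
qed (simp add: decon_Nil)

text \<open>The name stands for component: the part in length \<open>n\<close>, with all group
  elements recovered from the right end \<open>k\<close>.\<close>

definition comp :: "nat \<Rightarrow> 'g \<Rightarrow> ('x list \<Rightarrow>\<^sub>0 'k) \<Rightarrow> (('x \<times> 'g) list \<Rightarrow>\<^sub>0 'k)" where
  "comp n k v = lin (\<lambda>zs. if length zs = n then bas (path zs k) else 0) v"

lemma comp_linear [simp]:
  "comp n k (v + w) = comp n k v + comp n k w" "comp n k (smul c v) = smul c (comp n k v)"
  by (simp_all add: comp_def)

lemma comp_bas: "comp n k (bas zs) = (if length zs = n then bas (path zs k) else 0)"
  by (simp add: comp_def)

lemma comp_Suc:
  assumes "homogeneous w v"
  shows "comp (Suc n) k (push ((#) z) v) = push ((#) (z, w + k)) (comp n k v)"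
proof -
  have "comp (Suc n) k (push ((#) z) v)
      = lin (\<lambda>zs. if length zs = n then bas ((z, w + k) # path zs k) else 0) v"
    using assms by (simp add: comp_def) (intro lin_cong; simp add: homogeneous_def)
  also have "\<dots> = push ((#) (z, w + k)) (comp n k v)"
    by (simp add: comp_def if_distrib[of "push _"] cong: if_cong)
  finally show ?thesis .
qed

lemma comp_Suc_prd:
  "comp (Suc n) k (push ((#) z) (prd xs ys)) = push ((#) (z, wt xs + wt ys + k)) (comp n k (prd xs ys))"
  by (rule comp_Suc[OF homogeneous_prd])

lemma lin_prd_empty:
  "lin (\<lambda>zs. if zs = [] then c else 0) (prd xs ys) = (if xs = [] \<and> ys = [] then c else 0)"
  by (cases xs; cases ys) simp_all

lemma comp_0_prd: "comp 0 k (prd xs ys) = (if xs = [] \<and> ys = [] then bas [] else 0)"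
proof -
  have "comp 0 k (prd xs ys) = lin (\<lambda>zs. if zs = [] then bas [] else 0) (prd xs ys)"
    unfolding comp_def by (intro lin_cong) simp
  then show ?thesis by (simp only: lin_prd_empty)
qed

text \<open>For two nonempty words each coproduct keeps two cuts. Of the four pairs, the one with
  two group elements on the left is killed by \<open>qs_f\<close>; the other three are the summands
  of the recursion for \<open>prd\<close>. Counting from 0 puts summand \<open>n\<close> in length
  \<open>Suc n\<close>.\<close>

lemma piece_emb:
  "piece n (emb (xs, g), emb (ys, h)) = smul (Lw g ys * Rw h xs) (comp (Suc n) (g + h) (prd xs ys))"
proof (induction n arbitrary: xs g ys h)
  case 0
  consider "xs = []" "ys = []" | y ys' where "xs = []" "ys = y # ys'" | x xs' where "xs = x # xs'" "ys = []"
    | x xs' y ys' where "xs = x # xs'" "ys = y # ys'"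
    by (meson neq_Nil_conv)
  then show ?case
  proof cases
    case 1
    then show ?thesis by (simp add: piece_0 qs_f_emb comp_bas del: emb_simps)
  next
    case 2
    then show ?thesis
      by (cases ys') (simp_all add: piece_0 qs_f_emb comp_bas del: emb_simps)
  next
    case 3
    then show ?thesis
      by (cases xs') (simp_all add: piece_0 qs_f_emb comp_bas del: emb_simps)
  next
    case 4
    have "comp (Suc 0) (g + h) (prd (x # xs') (y # ys'))
        = (if xs' = [] \<and> ys' = [] then smul (t x y) (bas [(a x y, g + h)]) else 0)"
      by (simp add: comp_Suc_prd comp_0_prd L_0 R_0)
    with 4 show ?thesis
      by (cases xs'; cases ys') (simp_all add: piece_0 qs_f_emb ac_simps del: emb_simps prd.simps)
  qed
next
  case (Suc n)
  note simps = piece_Suc_emb lin_decon_short lin_decon_short[where h = "\<lambda>p. lin _ _"] qs_f_emb Suc.IH cons_tens_single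
  consider "xs = []" "ys = []" | y ys' where "xs = []" "ys = y # ys'" | x xs' where "xs = x # xs'" "ys = []"
    | x xs' y ys' where "xs = x # xs'" "ys = y # ys'"
    by (meson neq_Nil_conv)
  then show ?case
  proof cases
    case 1
    then show ?thesis by (simp add: simps comp_bas del: emb_simps)
  next
    case 2
    then show ?thesis
      by (simp add: simps comp_bas ac_simps del: emb_simps)
  next
    case 3
    then show ?thesis
      by (simp add: simps comp_bas ac_simps del: emb_simps)
  next
    case 4
    then show ?thesis
      by (simp add: simps comp_Suc_prd L_add R_add fvs.scale_right_distrib ac_simps del: emb_simps)
  qed
qed

lemma qs_mult_emb: "qs_mult M \<alpha> (emb u, emb v) = push emb (qmul (u, v))"
proof -
  obtain xs g ys h where eq: "u = (xs, g)" "v = (ys, h)" by (metis surj_pair)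
  define c where "c = Lw g ys * Rw h xs"
  \<comment> \<open>A bound on the lengths that occur makes the infinite sum finite; inserting 0
    keeps \<open>Max\<close> defined on an empty set.\<close>
  define N where "N = Max (insert 0 (length ` Poly_Mapping.keys (prd xs ys)))"
  have N: "length zs \<le> N" if "zs \<in> Poly_Mapping.keys (prd xs ys)" for zs
    unfolding N_def using that by (intro Max_ge) auto
  have push_comp: "push Word (comp (Suc n) k w)
      = lin (\<lambda>zs. if length zs = Suc n then bas (Word (path zs k)) else 0) w" for n k w
    by (simp add: comp_def if_distrib[of "push _"] cong: if_cong)
  have big: "comp (Suc n) (g + h) (prd xs ys) = 0" if "\<not> n < N" for n
  proof -
    have "comp (Suc n) (g + h) (prd xs ys) = lin (\<lambda>zs. 0) (prd xs ys)"
      unfolding comp_def using that by (intro lin_cong) (auto dest: N)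
    then show ?thesis by simp
  qed
  have "Sum_any (\<lambda>n. push Word (piece n (emb u, emb v)))
      = (\<Sum>n<N. push Word (smul c (comp (Suc n) (g + h) (prd xs ys))))"
    unfolding eq piece_emb c_def
    by (rule Sum_any.expand_superset) (auto intro: ccontr simp: big)
  also have "\<dots> = smul c (lin (\<lambda>zs. \<Sum>n<N. if length zs = Suc n then bas (Word (path zs (g + h))) else 0) (prd xs ys))"
    by (simp only: push_smul push_comp lin_fun_sum fvs.scale_sum_right)
  also have "lin (\<lambda>zs. \<Sum>n<N. if length zs = Suc n then bas (Word (path zs (g + h))) else 0) (prd xs ys)
      = lin (\<lambda>zs. if zs = [] then 0 else bas (emb (zs, g + h))) (prd xs ys)"
  proof (rule lin_cong)
    fix zs assume zs: "zs \<in> Poly_Mapping.keys (prd xs ys)"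
    show "(\<Sum>n<N. if length zs = Suc n then bas (Word (path zs (g + h))) else 0)
        = (if zs = [] then 0 else bas (emb (zs, g + h)) :: _ \<Rightarrow>\<^sub>0 'k)"
      using N[OF zs] by (cases zs) auto
  qed
  finally have words: "Sum_any (\<lambda>n. push Word (piece n (emb u, emb v)))
      = smul c (lin (\<lambda>zs. if zs = [] then 0 else bas (emb (zs, g + h))) (prd xs ys))" .
  \<comment> \<open>The empty word occurs in \<open>prd xs ys\<close> only when both words are
    empty, so the component \<open>g\<close> of the product supplies exactly the term missing from
    the sum over lengths.\<close>
  have "push Grp (qs_g (emb u, emb v)) = smul c (if xs = [] \<and> ys = [] then bas (Grp (g + h)) else 0)"
    by (auto simp: eq qs_g_def emb_def c_def mult_single)
  also have "\<dots> = smul c (lin (\<lambda>zs. if zs = [] then bas (Grp (g + h)) else 0) (prd xs ys))"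
    by (simp only: lin_prd_empty)
  finally have "qs_mult M \<alpha> (emb u, emb v) = smul c (lin (\<lambda>zs.
      (if zs = [] then bas (Grp (g + h)) else 0) + (if zs = [] then 0 else bas (emb (zs, g + h)))) (prd xs ys))"
    using words by (simp add: qs_mult_def piece_def lin_fun_add fvs.scale_right_distrib)
  also have "(\<lambda>zs. (if zs = [] then bas (Grp (g + h)) else 0) + (if zs = [] then 0 else bas (emb (zs, g + h))))
      = (\<lambda>zs. bas (emb (zs, g + h)))"
    by (auto simp: emb_def fun_eq_iff)
  finally show ?thesis
    by (simp add: qmul_def eq c_def push_def)
qed

theorem qs_hopf_is_hopf: "is_hopf_algebra (qs_hopf M \<alpha>)"
  by (rule hopf_algebra_along_embedding[OF inj_emb])
    (simp_all add: qs_hopf_def cotensor_carrier_eq qs_mult_emb word_comult_emb,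
      simp add: emb_def word_counit_def qcounit_def)

end

section \<open>Cocycle deformation\<close>

lemma bicharacter_add_left: "bicharacter \<sigma> \<Longrightarrow> \<sigma> (x + y) z = \<sigma> x z * \<sigma> y z"
  and bicharacter_add_right: "bicharacter \<sigma> \<Longrightarrow> \<sigma> x (y + z) = \<sigma> x y * \<sigma> x z"
  and bicharacter_nonzero: "bicharacter \<sigma> \<Longrightarrow> \<sigma> x y \<noteq> 0"
  by (simp_all add: bicharacter_def)

lemma bicharacter_0:
  assumes "bicharacter \<sigma>"
  shows "\<sigma> 0 y = 1" "\<sigma> x 0 = 1"
  using bicharacter_add_left[OF assms, of 0 0 y] bicharacter_add_right[OF assms, of x 0 0]
    bicharacter_nonzero[OF assms] by simp_all

lemma bicharacter_minus:
  assumes "bicharacter \<sigma>"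
  shows "\<sigma> (- x) y = inverse (\<sigma> x y)" "\<sigma> x (- y) = inverse (\<sigma> x y)"
proof -
  have "\<sigma> x y * \<sigma> (- x) y = 1" "\<sigma> x y * \<sigma> x (- y) = 1"
    using bicharacter_add_left[OF assms, of x "- x" y] bicharacter_add_right[OF assms, of x y "- y"]
    by (simp_all add: bicharacter_0[OF assms])
  then show "\<sigma> (- x) y = inverse (\<sigma> x y)" "\<sigma> x (- y) = inverse (\<sigma> x y)"
    by (metis inverse_unique)+
qed

lemma bicharacter_diff:
  assumes "bicharacter \<sigma>"
  shows "\<sigma> (x - z) y = \<sigma> x y * inverse (\<sigma> z y)" "\<sigma> x (y - z) = \<sigma> x y * inverse (\<sigma> x z)"
  using bicharacter_add_left[OF assms, of x "- z" y] bicharacter_add_right[OF assms, of x y "- z"]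
  by (simp_all add: bicharacter_minus[OF assms])

context quasi_shuffle_bimod
begin

section \<open>Convolution with forms concentrated in degree 0\<close>

lemma lfun_decon_left_group:
  assumes "\<And>x xs g v. h ((x # xs, g), v) = 0"
  shows "lfun h (decon u) = h (([], left_deg u), u)"
  unfolding lfun_eq_lin by (subst lin_decon_left_group) (simp_all add: assms)

lemma tensor_comult_emb: "tensor_comult (word_comult M) (emb u, emb v) =
    lin (\<lambda>p. lin (\<lambda>q. bas ((emb (fst p), emb (fst q)), (emb (snd p), emb (snd q)))) (decon v)) (decon u)"
  by (simp add: tensor_comult_def word_comult_emb case_prod_unfold push_def)

lemma pullback_form_emb:
  "pullback_form degree0_proj \<sigma> (emb u, emb v) = (if fst u = [] \<and> fst v = [] then \<sigma> (snd u) (snd v) else 0)"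
  by (auto simp: pullback_form_def degree0_proj_def emb_def tens_def)

lemma is_conv_inverse_iff:
  "is_conv_inverse (qs_hopf M \<alpha>) s s' \<longleftrightarrow>
     (\<forall>u v. convolution (qs_hopf M \<alpha>) s s' (bas (emb u, emb v)) = qcounit u * qcounit v \<and>
            convolution (qs_hopf M \<alpha>) s' s (bas (emb u, emb v)) = qcounit u * qcounit v)"
    (is "_ \<longleftrightarrow> ?basis")
proof
  define E where "E p = (emb (fst p), emb (snd p))" for p
  have "range E = range emb \<times> range emb"
    by (auto simp: E_def image_def)
  then have space: "tensor_space (hcarrier (qs_hopf M \<alpha>)) (hcarrier (qs_hopf M \<alpha>)) = range (push E)"
    by (simp add: qs_hopf_def cotensor_carrier_eq tensor_space_span_keys flip: span_keys_eq_range_push)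
  have counit: "word_counit (emb u) = qcounit u" for u
    by (simp add: word_counit_def emb_def qcounit_def)
  show ?basis if "is_conv_inverse (qs_hopf M \<alpha>) s s'"
  proof (intro allI)
    fix u v
    have "bas (emb u, emb v) = push E (bas (u, v))" by (simp add: E_def)
    then have "bas (emb u, emb v) \<in> tensor_space (hcarrier (qs_hopf M \<alpha>)) (hcarrier (qs_hopf M \<alpha>))"
      unfolding space by (metis rangeI)
    from that[unfolded is_conv_inverse_def, rule_format, OF this]
    show "convolution (qs_hopf M \<alpha>) s s' (bas (emb u, emb v)) = qcounit u * qcounit v \<and>
        convolution (qs_hopf M \<alpha>) s' s (bas (emb u, emb v)) = qcounit u * qcounit v"
      by (simp add: qs_hopf_def counit)
  qed
  show "is_conv_inverse (qs_hopf M \<alpha>) s s'" if ?basis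
    unfolding is_conv_inverse_def
  proof
    fix x assume "x \<in> tensor_space (hcarrier (qs_hopf M \<alpha>)) (hcarrier (qs_hopf M \<alpha>))"
    then obtain w where w: "x = push E w" unfolding space by blast
    have "convolution (qs_hopf M \<alpha>) f f' x
        = lfun (\<lambda>p. convolution (qs_hopf M \<alpha>) f f' (bas (emb (fst p), emb (snd p)))) w" for f f'
      by (simp add: convolution_def w E_def)
    moreover have "convolution (qs_hopf M \<alpha>) s s' (bas (emb b, emb c)) = qcounit b * qcounit c"
      "convolution (qs_hopf M \<alpha>) s' s (bas (emb b, emb c)) = qcounit b * qcounit c" for b c
      using that by blast+
    moreover have "lfun (\<lambda>(b, c). hcounit (qs_hopf M \<alpha>) b * hcounit (qs_hopf M \<alpha>) c) x
        = lfun (\<lambda>p. qcounit (fst p) * qcounit (snd p)) w"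
      by (simp add: w E_def qs_hopf_def counit)
    ultimately show "convolution (qs_hopf M \<alpha>) s s' x
          = lfun (\<lambda>(b, c). hcounit (qs_hopf M \<alpha>) b * hcounit (qs_hopf M \<alpha>) c) x \<and>
        convolution (qs_hopf M \<alpha>) s' s x
          = lfun (\<lambda>(b, c). hcounit (qs_hopf M \<alpha>) b * hcounit (qs_hopf M \<alpha>) c) x"
      by simp
  qed
qed

text \<open>Since \<open>s\<close> kills positive degrees, both coproducts reduce to the cut with
  empty left part, which leaves \<open>s\<close> at the left ends and \<open>s'\<close> at the whole
  words.\<close>

lemma convolution_emb:
  assumes "\<And>x xs g v. s (emb (x # xs, g), v) = 0" "\<And>x xs g v. s (v, emb (x # xs, g)) = 0"
  shows "convolution (qs_hopf M \<alpha>) s s' (bas (emb u, emb v))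
       = s (Grp (left_deg u), Grp (left_deg v)) * s' (emb u, emb v)"
proof -
  have "convolution (qs_hopf M \<alpha>) s s' (bas (emb u, emb v)) =
      lfun (\<lambda>p. lfun (\<lambda>q. s (emb (fst p), emb (fst q)) * s' (emb (snd p), emb (snd q))) (decon v)) (decon u)"
    by (simp add: convolution_def qs_hopf_def tensor_comult_emb)
  also have "\<dots> = lfun (\<lambda>q. s (Grp (left_deg u), emb (fst q)) * s' (emb u, emb (snd q))) (decon v)"
    using assms by (subst lfun_decon_left_group) simp_all
  also have "\<dots> = s (Grp (left_deg u), Grp (left_deg v)) * s' (emb u, emb v)"
    using assms by (subst lfun_decon_left_group) simp_all
  finally show ?thesis .
qed

text \<open>\<open>conv_inv\<close> is a choice, so an inverse is exhibited first, the pullback of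
  the pointwise inverse. By \<open>convolution_emb\<close> the value of any inverse is then found by
  dividing by the nonzero value of \<sigma> at the left ends.\<close>

lemma conv_inv_emb:
  assumes \<sigma>: "bicharacter \<sigma>"
  shows "conv_inv (qs_hopf M \<alpha>) (pullback_form degree0_proj \<sigma>) (emb u, emb v)
       = (if fst u = [] \<and> fst v = [] then inverse (\<sigma> (snd u) (snd v)) else 0)"
proof -
  let ?B = "qs_hopf M \<alpha>" and ?s = "pullback_form degree0_proj \<sigma> :: _ \<Rightarrow> 'k"
  define s' where "s' = (pullback_form degree0_proj (\<lambda>g h. inverse (\<sigma> g h)) :: ('g, 'x \<times> 'g) word \<times> ('g, 'x \<times> 'g) word \<Rightarrow> 'k)"
  have group: "pullback_form degree0_proj f (Grp g, Grp h) = f g h" for f and g h :: 'g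
    by (simp add: pullback_form_def degree0_proj_def)
  have vanish: "pullback_form degree0_proj f (emb (x # xs, g), v) = 0"
    "pullback_form degree0_proj f (v, emb (x # xs, g)) = 0" for f x xs v and g :: 'g
    by (simp_all add: pullback_form_def degree0_proj_def tens_def split: prod.split)
  have conv: "convolution ?B (pullback_form degree0_proj f) s'' (bas (emb u, emb v))
      = f (left_deg u) (left_deg v) * s'' (emb u, emb v)" for f s'' u v
    by (simp only: convolution_emb[where s = "pullback_form degree0_proj f", OF vanish] group)
  have "is_conv_inverse ?B ?s s'"
    unfolding is_conv_inverse_iff s'_def conv
    by (auto simp: pullback_form_emb qcounit_def left_deg_def
        bicharacter_nonzero[OF \<sigma>])
  then have "is_conv_inverse ?B ?s (conv_inv ?B ?s)"
    unfolding conv_inv_def by (rule someI[where P = "is_conv_inverse ?B ?s"])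
  then have "\<sigma> (left_deg u) (left_deg v) * conv_inv ?B ?s (emb u, emb v) = qcounit u * qcounit v"
    unfolding is_conv_inverse_iff conv by blast
  then show ?thesis
    using bicharacter_nonzero[OF \<sigma>, of "left_deg u" "left_deg v"]
    by (auto simp: qcounit_def left_deg_def field_simps split: if_splits)
qed

lemma cocycle_deform_emb:
  assumes \<sigma>: "bicharacter \<sigma>"
  shows "hmult (cocycle_deform (qs_hopf M \<alpha>) (pullback_form degree0_proj \<sigma>)) (emb u, emb v)
       = smul (\<sigma> (left_deg u) (left_deg v) * inverse (\<sigma> (snd u) (snd v))) (push emb (qmul (u, v)))"
proof -
  define c where "c = conv_inv (qs_hopf M \<alpha>) (pullback_form degree0_proj \<sigma>)"
  have c: "c (emb u, emb v) = (if fst u = [] \<and> fst v = [] then inverse (\<sigma> (snd u) (snd v)) else 0)" for u v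
    unfolding c_def by (rule conv_inv_emb[OF \<sigma>])
  define s where "s = (pullback_form degree0_proj \<sigma> :: ('g, 'x \<times> 'g) word \<times> ('g, 'x \<times> 'g) word \<Rightarrow> 'k)"
  have s: "s (emb u, emb v) = (if fst u = [] \<and> fst v = [] then \<sigma> (snd u) (snd v) else 0)" for u v
    unfolding s_def by (rule pullback_form_emb)
  \<comment> \<open>\<open>K\<close> is the product convolved on the right with the inverse form;
    evaluating it first leaves a single convolution with \<sigma> on the left.\<close>
  define K where "K u v = lin (\<lambda>p. lin (\<lambda>q. smul (c (emb (snd p), emb (snd q)))
      (push emb (qmul (fst p, fst q)))) (decon v)) (decon u)" for u v
  have K: "K u v = smul (inverse (\<sigma> (snd u) (snd v))) (push emb (qmul (u, v)))" for u v
  proof -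
    have "K u v = lin (\<lambda>q. smul (c (emb ([], snd u), emb (snd q))) (push emb (qmul (u, fst q)))) (decon v)"
      unfolding K_def by (subst lin_decon_right_group) (simp_all add: c del: emb_simps)
    also have "\<dots> = smul (inverse (\<sigma> (snd u) (snd v))) (push emb (qmul (u, v)))"
      by (subst lin_decon_right_group) (simp_all add: c del: emb_simps)
    finally show ?thesis .
  qed
  have "hmult (cocycle_deform (qs_hopf M \<alpha>) s) (emb u, emb v) =
      lin (\<lambda>p. lin (\<lambda>q. lin (\<lambda>p'. lin (\<lambda>q'.
        smul (s (emb (fst p), emb (fst q)) * c (emb (snd p'), emb (snd q'))) (push emb (qmul (fst p', fst q'))))
          (decon (snd q))) (decon (snd p))) (decon v)) (decon u)"
    by (simp add: cocycle_deform_def qs_hopf_def[of M] tmap_def tens_def case_prod_unfold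
        tensor_comult_emb qs_mult_emb) (simp add: c_def s_def qs_hopf_def)
  also have "\<dots> = lin (\<lambda>p. lin (\<lambda>q. smul (s (emb (fst p), emb (fst q))) (K (snd p) (snd q))) (decon v)) (decon u)"
    by (simp only: K_def lin_fun_smul[symmetric] fvs.scale_scale)
  also have "\<dots> = lin (\<lambda>q. smul (s (emb ([], left_deg u), emb (fst q))) (K u (snd q))) (decon v)"
    by (subst lin_decon_left_group) (simp_all add: s del: emb_simps)
  also have "\<dots> = smul (\<sigma> (left_deg u) (left_deg v)) (K u v)"
    by (subst lin_decon_left_group) (simp_all add: s del: emb_simps)
  finally show ?thesis by (simp add: s_def K)
qed

end

text \<open>A basis element with letter x and group element k has left degree deg x + k and right
  degree k, so the twisting factor of either action retains only deg x. For \<open>E i\<close> and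
  \<open>F i\<close> the last assumption reads sigma(K_i, K'_i) = 1, up to an inverse.\<close>

locale twisted_quasi_shuffle = quasi_shuffle deg L R t a
  for deg :: "'x \<Rightarrow> 'g::ab_group_add" and L R :: "'g \<Rightarrow> 'x \<Rightarrow> 'k::field"
    and t :: "'x \<Rightarrow> 'x \<Rightarrow> 'k" and a :: "'x \<Rightarrow> 'x \<Rightarrow> 'x" +
  fixes \<sigma> :: "'g \<Rightarrow> 'g \<Rightarrow> 'k" and L' R' :: "'g \<Rightarrow> 'x \<Rightarrow> 'k"
  assumes \<sigma>: "bicharacter \<sigma>"
    and L': "L' g x = \<sigma> g (deg x) * L g x" and R': "R' g x = \<sigma> (deg x) g * R g x"
    and \<sigma>_deg: "t x y \<noteq> 0 \<Longrightarrow> \<sigma> (deg x) (deg y) = 1"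
begin

lemmas bichar = bicharacter_add_left[OF \<sigma>] bicharacter_add_right[OF \<sigma>] bicharacter_0[OF \<sigma>]

sublocale tw: quasi_shuffle deg L' R' t a
  by unfold_locales
    (simp_all add: L' R' bichar L_add R_add L_0 R_0 deg_a L_a R_a t_nilpotent ac_simps)

text \<open>In the merging summand the new factors are sigma(wt xs, deg y), sigma(deg x, wt ys) and,
  by induction, sigma(wt xs, wt ys). They fall short of the claim by sigma(deg x, deg y), which is 1
  by \<open>\<sigma>_deg\<close>.\<close>

lemma tw_prd: "tw.prd xs ys = smul (\<sigma> (wt xs) (wt ys)) (prd xs ys)"
proof (induction xs ys rule: prd.induct)
  case (3 x xs y ys)
  show ?case
    unfolding tw.prd.simps 3 push_smul using \<sigma>_deg[of x y]
    by (cases "t x y = 0") (simp_all add: L' R' bichar fvs.scale_right_distrib ac_simps)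
qed (simp_all add: bichar)

lemma tw_Lw: "tw.Lw g xs = \<sigma> g (wt xs) * Lw g xs"
  unfolding tw.Lw_def Lw_def by (induction xs) (simp_all add: L' bichar)

lemma tw_Rw: "tw.Rw g xs = \<sigma> (wt xs) g * Rw g xs"
  unfolding tw.Rw_def Rw_def by (induction xs) (simp_all add: R' bichar)

text \<open>Sigma of the left ends has four factors by bimultiplicativity. Three come from
  \<open>tw_prd\<close>, \<open>tw_Lw\<close> and \<open>tw_Rw\<close>; the fourth, sigma of the
  right ends, is divided out.\<close>

lemma tw_qmul: "tw.qmul (u, v)
    = smul (\<sigma> (left_deg u) (left_deg v) * inverse (\<sigma> (snd u) (snd v))) (qmul (u, v))"
  using bicharacter_nonzero[OF \<sigma>]
  by (simp add: tw.qmul_def qmul_def tw_prd tw_Lw tw_Rw left_deg_def bichar)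

end

section \<open>The multiparameter quantum group\<close>

definition unit_vec :: "'s \<Rightarrow> ('s \<Rightarrow> int)" where
  "unit_vec s = (\<lambda>s'. if s' = s then 1 else 0)"

lemma gK_unit_vec: "gK i = unit_vec (Inl i)" "gK' i = unit_vec (Inr i)"
  by (auto simp: gK_def gK'_def unit_vec_def)

text \<open>The group is free on the unit vectors, so two characters can be compared there.\<close>

lemma character_eq_prod:
  fixes \<chi> :: "('s::finite \<Rightarrow> int) \<Rightarrow> 'k::field"
  assumes add: "\<And>K K'. \<chi> (K + K') = \<chi> K * \<chi> K'" and nz: "\<And>K. \<chi> K \<noteq> 0"
  shows "\<chi> K = (\<Prod>s\<in>UNIV. \<chi> (unit_vec s) powi K s)"
proof -
  have zero: "\<chi> 0 = 1"
    using add[of 0 0] nz[of 0] by simp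
  have single: "\<chi> (\<lambda>s'. if s' = s then n else 0) = \<chi> (unit_vec s) powi n" for s n
  proof -
    let ?e = "\<lambda>n s'. if s' = s then n else (0 :: int)"
    have step: "\<chi> (?e (n + 1)) = \<chi> (?e n) * \<chi> (unit_vec s)" for n
      unfolding add[symmetric] by (rule arg_cong[of _ _ \<chi>]) (auto simp: unit_vec_def)
    show ?thesis
    proof (induction n rule: int_induct[of _ 0])
      case base
      then show ?case using zero by (simp add: zero_fun_def)
    next
      case (step1 i)
      then show ?case using nz by (simp add: step power_int_add)
    next
      case (step2 i)
      have "?e (i - 1 + 1) = ?e i" by (rule ext) simp
      with step2 show ?case
        using nz step[of "i - 1"] by (simp add: power_int_diff field_simps del: diff_add_cancel)
    qed
  qed
  have sum: "\<chi> (\<Sum>s\<in>S. f s) = (\<Prod>s\<in>S. \<chi> (f s))" if "finite S" for S :: "'s set" and f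
    using that by (induction S) (simp_all add: zero add del: plus_fun_apply zero_fun_apply)
  have "K = (\<Sum>s\<in>UNIV. (\<lambda>s'. if s' = s then K s else 0))"
  proof
    fix x
    have "(\<Sum>s\<in>S. f s) x = (\<Sum>s\<in>S. f s x)" for S and f :: "'s \<Rightarrow> 's \<Rightarrow> int"
      by (induction S rule: infinite_finite_induct) simp_all
    then show "K x = (\<Sum>s\<in>UNIV. (\<lambda>s'. if s' = s then K s else 0)) x" by simp
  qed
  then show ?thesis
    using sum[of UNIV "\<lambda>s s'. if s' = s then K s else 0"] by (simp add: single)
qed

text \<open>Only the value at a pair \<open>E i\<close>, \<open>F i\<close> matters; all other
  values are placeholders that meet the coefficient 0.\<close>

fun merge :: "'i letter \<Rightarrow> 'i letter \<Rightarrow> 'i letter" where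
  "merge (E i) y = Xi i"
| "merge x y = x"

text \<open>The eigenvalue \<lambda> in \<alpha> is absent because the character \<open>L\<close>
  supplies it.\<close>

fun merge_coeff :: "('i \<Rightarrow> 'i \<Rightarrow> 'k::field) \<Rightarrow> 'i letter \<Rightarrow> 'i letter \<Rightarrow> 'k" where
  "merge_coeff q (E i) (F j) = (if i = j then q i i / (q i i - 1) else 0)"
| "merge_coeff q _ _ = 0"

lemma merge_coeff_nonzero:
  assumes "merge_coeff q x y \<noteq> 0"
  obtains i where "x = E i" "y = F i"
  using assms by (cases "(q, x, y)" rule: merge_coeff.cases) (auto split: if_splits)

context
  fixes q :: "'i::finite \<Rightarrow> 'i \<Rightarrow> 'k::field"
  assumes q_nonzero: "\<And>i j. q i j \<noteq> 0"
begin

lemma gen_eigenvalue_nonzero: "gen_eigenvalue q s x \<noteq> 0"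
  by (cases s; cases x) (simp_all add: q_nonzero)

lemma eigenvalue_add: "eigenvalue q (g + h) x = eigenvalue q g x * eigenvalue q h x"
  by (simp add: eigenvalue_def power_int_add gen_eigenvalue_nonzero prod.distrib)

lemma eigenvalue_0: "eigenvalue q 0 x = 1"
  by (simp add: eigenvalue_def)

lemma eigenvalue_nonzero: "eigenvalue q g x \<noteq> 0"
  by (simp add: eigenvalue_def gen_eigenvalue_nonzero)

lemma eigenvalue_unit_vec: "eigenvalue q (unit_vec s) x = gen_eigenvalue q s x"
proof -
  have "eigenvalue q (unit_vec s) x = (\<Prod>s'\<in>UNIV. if s' = s then gen_eigenvalue q s x else 1)"
    unfolding eigenvalue_def by (rule prod.cong) (auto simp: unit_vec_def)
  then show ?thesis by simp
qed

text \<open>Each generator acts on \<open>E i\<close> and \<open>F i\<close> by mutually inverse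
  scalars and trivially on \<open>Xi i\<close>.\<close>

lemma eigenvalue_Xi: "eigenvalue q g (Xi i) = eigenvalue q g (E i) * eigenvalue q g (F i)"
proof -
  have "gen_eigenvalue q s (Xi i) = gen_eigenvalue q s (E i) * gen_eigenvalue q s (F i)" for s
    by (cases s) (simp_all add: q_nonzero)
  then show ?thesis
    by (simp add: eigenvalue_def power_int_mult_distrib prod.distrib)
qed

lemma quasi_shuffle_quantum:
  "quasi_shuffle letter_degree (eigenvalue q) (\<lambda>_ _. 1) (merge_coeff q) merge"
proof
  fix x y assume "merge_coeff q x y \<noteq> 0"
  then obtain i where [simp]: "x = E i" "y = F i" by (rule merge_coeff_nonzero)
  show "letter_degree (merge x y) = letter_degree x + letter_degree y" by simp
  show "eigenvalue q g (merge x y) = eigenvalue q g x * eigenvalue q g y" for g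
    by (simp add: eigenvalue_Xi)
  show "merge_coeff q (merge x y) z = 0" "merge_coeff q z (merge x y) = 0" for z
    by (simp, cases z) simp_all
qed (simp_all add: eigenvalue_add eigenvalue_0)

lemma quasi_shuffle_bimod_quantum:
  "quasi_shuffle_bimod letter_degree (eigenvalue q) (\<lambda>_ _. 1) (merge_coeff q) merge (M_bimod q) (\<alpha>_M q)"
proof (intro quasi_shuffle_bimod.intro quasi_shuffle_quantum quasi_shuffle_bimod_axioms.intro)
  show "\<alpha>_M q ((x, k), (y, l)) = smul (eigenvalue q k y * 1 * merge_coeff q x y) (bas (merge x y, k + l))"
    for x k y l
    by (cases "(q, x, y)" rule: merge_coeff.cases) (simp_all add: \<alpha>_M_def mult.commute split: letter.split)
qed (auto simp: M_bimod_def fun_eq_iff)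

end

lemma inj_\<phi>_iso:
  fixes \<sigma> :: "'i \<Gamma> \<Rightarrow> 'i \<Gamma> \<Rightarrow> 'k::field"
  assumes "bicharacter \<sigma>"
  shows "inj (lin (\<phi>_iso \<sigma>))"
proof (rule inj_on_inverseI)
  fix v :: "'i mbasis \<Rightarrow>\<^sub>0 'k"
  show "lin (\<lambda>(x, K). smul (inverse (\<sigma> (letter_degree x) (- K))) (bas (x, K))) (lin (\<phi>_iso \<sigma>) v) = v"
    by (simp add: \<phi>_iso_def case_prod_unfold bicharacter_nonzero[OF assms])
qed

text \<open>
  Both sides are multiplicative in \<open>K\<close>, and on generators this is the hypothesis on
  \<open>\<sigma>(K\<^sub>i, K'\<^sub>j)\<close> and \<open>\<sigma>(K'\<^sub>i, K'\<^sub>j)\<close>.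
\<close>

lemma eigenvalue_twist:
  fixes q qhat :: "'i::finite \<Rightarrow> 'i \<Rightarrow> 'k::field"
  assumes q: "\<And>i j. q i j \<noteq> 0"
    and qq: "\<And>i j. qhat i j * qhat j i = q i j * q j i"
    and \<sigma>: "bicharacter \<sigma>"
    and KK: "\<And>i j. \<sigma> (gK' i) (gK' j) * inverse (\<sigma> (gK' j) (gK' i)) = qhat i j * inverse (q i j)"
    and K'K: "\<And>i j. \<sigma> (gK' i) (gK j) * inverse (\<sigma> (gK j) (gK' i)) = inverse (qhat j i) * q j i"
  shows "\<sigma> (letter_degree (F j)) K * eigenvalue qhat K (F j) = \<sigma> K (letter_degree (F j)) * eigenvalue q K (F j)"
proof -
  have qhat: "qhat i j \<noteq> 0" for i j
    using qq[of i j] q[of i j] q[of j i] by auto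
  note nz = bicharacter_nonzero[OF \<sigma>]
  define \<chi> \<chi>' where "\<chi> K = \<sigma> (letter_degree (F j)) K * eigenvalue qhat K (F j)"
    and "\<chi>' K = \<sigma> K (letter_degree (F j)) * eigenvalue q K (F j)" for K
  have \<chi>: "\<chi> K = (\<Prod>s\<in>UNIV. \<chi> (unit_vec s) powi K s)"
    by (rule character_eq_prod)
      (simp_all del: plus_fun_apply add: \<chi>_def bicharacter_add_right[OF \<sigma>] eigenvalue_add qhat nz eigenvalue_nonzero)
  have \<chi>': "\<chi>' K = (\<Prod>s\<in>UNIV. \<chi>' (unit_vec s) powi K s)"
    by (rule character_eq_prod)
      (simp_all del: plus_fun_apply add: \<chi>'_def bicharacter_add_left[OF \<sigma>] eigenvalue_add q nz eigenvalue_nonzero)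
  note gen = eigenvalue_unit_vec[of q "Inl _", OF q, folded gK_unit_vec] eigenvalue_unit_vec[of q "Inr _", OF q, folded gK_unit_vec]
    eigenvalue_unit_vec[of qhat "Inl _", OF qhat, folded gK_unit_vec] eigenvalue_unit_vec[of qhat "Inr _", OF qhat, folded gK_unit_vec]
  have "\<chi> (unit_vec s) = \<chi>' (unit_vec s)" for s
  proof (cases s)
    case (Inl i)
    have "\<sigma> (gK' j) (gK i) * qhat i j = \<sigma> (gK i) (gK' j) * q i j"
      using K'K[of j i] nz qhat by (simp add: field_simps)
    then show ?thesis
      using nz q qhat
      by (simp add: \<chi>_def \<chi>'_def Inl gK_unit_vec[symmetric] gen bicharacter_minus[OF \<sigma>] field_simps)
  next
    case (Inr i)
    have "\<sigma> (gK' i) (gK' j) * q i j = \<sigma> (gK' j) (gK' i) * qhat i j"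
      using KK[of i j] nz q by (simp add: field_simps)
    \<comment> \<open>The hypothesis involves \<open>qhat i j\<close>, but K'_i acts on F_j through
      the transposed entry; the equality of the products of opposite entries passes from one to the
      other.\<close>
    then have "q i j * (qhat j i * \<sigma> (gK' i) (gK' j)) = q i j * (q j i * \<sigma> (gK' j) (gK' i))"
      using qq[of i j] by algebra
    then have "qhat j i * \<sigma> (gK' i) (gK' j) = q j i * \<sigma> (gK' j) (gK' i)"
      using q by simp
    then show ?thesis
      using nz q qhat
      by (simp add: \<chi>_def \<chi>'_def Inr gK_unit_vec[symmetric] gen bicharacter_minus[OF \<sigma>] field_simps)
  qed
  then have "\<chi> K = \<chi>' K"
    by (subst \<chi>, subst \<chi>') simp
  then show ?thesis by (simp only: \<chi>_def \<chi>'_def)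
qed

theorem proposition4p6:
  fixes A :: "'i::finite \<Rightarrow> 'i \<Rightarrow> int"
    and q qhat :: "'i \<Rightarrow> 'i \<Rightarrow> 'k::{alg_closed_field, field_char_0}"
    and \<sigma> :: "'i \<Gamma> \<Rightarrow> 'i \<Gamma> \<Rightarrow> 'k"
  assumes "symmetrizable_GCM A"
    and "\<And>i j. q i j \<noteq> 0"
    and "\<And>i j. q i j * q j i = q i i powi A i j"
    and "\<And>i. q i i \<noteq> 1"
    and "\<And>i. qhat i i = q i i"
    and "\<And>i j. qhat i j * qhat j i = q i j * q j i"
    and "bicharacter \<sigma>"
    and "\<And>i j. \<sigma> (gK i) (gK j) * inverse (\<sigma> (gK j) (gK i)) = qhat i j * inverse (q i j)"
    and "\<And>i j. \<sigma> (gK' i) (gK' j) * inverse (\<sigma> (gK' j) (gK' i)) = qhat i j * inverse (q i j)"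
    and "\<And>i j. \<sigma> (gK' i) (gK j) * inverse (\<sigma> (gK j) (gK' i)) = inverse (qhat j i) * q j i"
    and "\<And>i. \<sigma> (gK i) (gK' i) = 1"
  shows "is_hopf_iso
           (qs_hopf (twist_bimod \<sigma> (M_bimod q)) (\<alpha>_twisted qhat \<sigma>))
           (cocycle_deform (qs_hopf (M_bimod q) (\<alpha>_M q)) (pullback_form degree0_proj \<sigma>))
           id"
proof -
  note q = assms(2) and q_diag = assms(5) and \<sigma> = assms(7)
  define L' where "L' g x = \<sigma> g (letter_degree x) * eigenvalue q g x" for g x
  define R' where "R' g x = \<sigma> (letter_degree x) g * (1 :: 'k)" for g and x :: "'i letter"
  note nz = bicharacter_nonzero[OF \<sigma>]
  note \<sigma>_simps = bicharacter_add_left[OF \<sigma>] bicharacter_add_right[OF \<sigma>] bicharacter_minus[OF \<sigma>]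
    bicharacter_diff[OF \<sigma>]

  interpret M: quasi_shuffle_bimod letter_degree "eigenvalue q" "\<lambda>_ _. 1" "merge_coeff q" merge
    "M_bimod q" "\<alpha>_M q"
    by (rule quasi_shuffle_bimod_quantum[OF q])
  interpret twisted_quasi_shuffle letter_degree "eigenvalue q" "\<lambda>_ _. 1" "merge_coeff q" merge \<sigma> L' R'
  proof
    fix x y assume "merge_coeff q x y \<noteq> 0"
    then obtain i where "x = E i" "y = F i" by (rule merge_coeff_nonzero)
    then show "\<sigma> (letter_degree x) (letter_degree y) = 1"
      using assms(11) by (simp add: \<sigma>_simps)
  qed (simp_all add: \<sigma> L'_def R'_def)

  let ?M' = "twist_bimod \<sigma> (M_bimod q)" and ?\<alpha>' = "\<alpha>_twisted qhat \<sigma>"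
  have alpha: "?\<alpha>' ((x, k), (y, l)) = smul (L' k y * R' l x * merge_coeff q x y) (bas (merge x y, k + l))"
    for x k y l
  proof -
    \<comment> \<open>Instead of inverting the isomorphism, it is applied to the claimed value;
      injectivity then gives the formula for the twisted \<alpha>.\<close>
    have "lin (\<alpha>_M qhat) (tmap (\<phi>_iso \<sigma>) (\<phi>_iso \<sigma>) ((x, k), (y, l)))
        = lin (\<phi>_iso \<sigma>) (smul (L' k y * R' l x * merge_coeff q x y) (bas (merge x y, k + l)))"
    proof (cases "merge_coeff q x y = 0")
      case True
      have "\<alpha>_M qhat ((x, k), (y, l)) = 0"
        using True assms(4) q
        by (cases "(q, x, y)" rule: merge_coeff.cases)
          (auto simp: \<alpha>_M_def q_diag split: letter.split if_splits)
      with True show ?thesis by (simp add: \<phi>_iso_def tmap_def)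
    next
      case False
      then obtain i where [simp]: "x = E i" "y = F i" by (rule merge_coeff_nonzero)
      \<comment> \<open>After the factors of the isomorphism at E_i, F_i and xi_i cancel, sigma(K_i,
        l) and the inverse of sigma(K'_i, k) remain. The first is \<open>R'\<close>, and the second
        turns the hatted eigenvalue into \<open>L'\<close>.\<close>
      have "L' k y = \<sigma> (letter_degree (F i)) k * eigenvalue qhat k (F i)"
        by (simp only: L'_def \<open>y = F i\<close> eigenvalue_twist[OF q assms(6) \<sigma> assms(9,10)])
      then have "eigenvalue qhat k (F i) = \<sigma> (gK' i) k * L' k (F i)"
        using nz by (simp add: \<sigma>_simps field_simps)
      then show ?thesis
        using nz by (simp add: \<phi>_iso_def tmap_def \<alpha>_M_def q_diag R'_def \<sigma>_simps field_simps)
    qed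
    then show ?thesis
      unfolding \<alpha>_twisted_def by (simp only: inv_f_f[OF inj_\<phi>_iso[OF \<sigma>]])
  qed
  interpret M': quasi_shuffle_bimod letter_degree L' R' "merge_coeff q" merge ?M' ?\<alpha>'
  proof (intro quasi_shuffle_bimod.intro tw.quasi_shuffle_axioms quasi_shuffle_bimod_axioms.intro alpha)
    show "lact ?M' (h, (x, k)) = smul (L' h x) (bas (x, h + k))" for h x k
      using nz by (simp add: twist_bimod_def bicoact_def M_bimod_def tmap_def L'_def \<sigma>_simps field_simps)
    show "ract ?M' ((x, k), h) = smul (R' h x) (bas (x, k + h))" for h x k
      using nz by (simp add: twist_bimod_def bicoact_def M_bimod_def tmap_def R'_def \<sigma>_simps field_simps)
  qed (simp_all add: twist_bimod_def M_bimod_def fun_eq_iff)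

  let ?B = "qs_hopf ?M' ?\<alpha>'"
    and ?C = "cocycle_deform (qs_hopf (M_bimod q) (\<alpha>_M q)) (pullback_form degree0_proj \<sigma>)"
  \<comment> \<open>The embedding of words depends only on degrees, which twisting leaves alone, so
    one \<open>emb\<close> serves both bimodules.\<close>
  have mult: "hmult ?B (M.emb u, M.emb v) = push M.emb (tw.qmul (u, v))"
    "hmult ?C (M.emb u, M.emb v) = push M.emb (tw.qmul (u, v))" for u v
    by (simp add: qs_hopf_def M'.qs_mult_emb) (simp add: M.cocycle_deform_emb[OF \<sigma>] tw_qmul)
  have comult: "word_comult ?M' = word_comult (M_bimod q)"
    by (simp add: fun_eq_iff word_comult_def twist_bimod_def split: word.split)
  have carrier: "hcarrier ?B = range (push M.emb)" "hcarrier ?C = range (push M.emb)"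
    by (simp_all add: qs_hopf_def cocycle_deform_def M'.cotensor_carrier_eq M.cotensor_carrier_eq
        span_keys_eq_range_push)
  \<comment> \<open>By \<open>mult\<close> the deformed product has the structure constants of the
    twisted quasi-shuffle algebra, whose axioms transfer along the embedding.\<close>
  have "is_hopf_algebra ?C"
    by (rule tw.hopf_algebra_along_embedding[OF M.inj_emb])
      (simp_all only: mult, simp_all add: cocycle_deform_def qs_hopf_def M.cotensor_carrier_eq
        M.word_comult_emb, simp add: M.emb_def word_counit_def M.qcounit_def)
  moreover have "is_hopf_algebra ?B"
    by (rule M'.qs_hopf_is_hopf)
  moreover have "lin (hmult ?B) (tens v w) = lin (hmult ?C) (tens v w)"
    if "v \<in> hcarrier ?B" "w \<in> hcarrier ?B" for v w
    using that by (auto simp: carrier mult)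
  moreover have "hunit ?B = hunit ?C" "hcomult ?B = hcomult ?C" "hcounit ?B = hcounit ?C"
    by (simp_all add: qs_hopf_def cocycle_deform_def comult)
  moreover have "lin (tmap (\<lambda>b. id (bas b)) (\<lambda>b. id (bas b))) v = v"
    for v :: "('i \<Gamma>, 'i mbasis) word \<times> ('i \<Gamma>, 'i mbasis) word \<Rightarrow>\<^sub>0 'k"
    by (simp add: tmap_def case_prod_unfold)
  moreover have "Vector_Spaces.linear smul smul id"
    by (rule fvs.linear_id)
  ultimately show ?thesis
    unfolding is_hopf_iso_def by (simp add: carrier)
qed

end
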